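(* Let $J=W(\{a_n\},\{b_n\})$ be the symmetric Jacobi matrix with diagonal entries $\{b_n\}_{n=-\infty}^{\infty}$ and off-diagonal entries $\{a_n\}_{n=-\infty}^{\infty}$. Assume that $\sum_{n} |b_n|<\infty$, $\sum_{n}(a_n-1)_+<\infty$ and $\lim_{n\to\pm\infty}a_n=1$. Let $E_j^+(J)$ denote the eigenvalues of $J$ that are larger than $2$ and $E_j^-(J)$ the eigenvalues of $J$ that are less than $-2$. Then $$ \sum_j \Big[\big(E_j^+(J)^2-4\big)^{1/2}+\big(E_j^-(J)^2-4\big)^{1/2}\Big]\le \sum_{n}|b_n|+4\sum_{n}(a_n-1)_+ , $$ where the left-hand side is the sum over all eigenvalues $E_j^+(J)$ and all eigenvalues $E_j^-(J)$, and the sums over $n$ run over $\mathbb{Z}$.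
   Context: For real sequences $\{a_n\}_{n\in\mathbb{Z}}$, $\{b_n\}_{n\in\mathbb{Z}}$ (bounded), $W(\{a_n\},\{b_n\})$ denotes the symmetric tridiagonal (Jacobi) matrix with diagonal entries $b_n$ and off-diagonal entries $a_n$, i.e. the bounded self-adjoint operator on $\ell^2(\mathbb{Z})$ given by $(Ju)_n=a_{n-1}u_{n-1}+b_nu_n+a_nu_{n+1}$. Since $a_n\to1$ and $b_n\to0$ as $n\to\pm\infty$, its essential spectrum is $[-2,2]$. Eigenvalues are repeated according to multiplicity. For real $x$, $(x)_+=x$ if $x>0$ and $(x)_+=0$ if $x\le0$.
   Formalization: The off-diagonal entries are assumed to satisfy a_n ≥ -1 (this includes the usual a_n > 0); for arbitrary real a_n the inequality fails, e.g. b = 0, a_0 = -5 and all other a_n = 1. *)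

theory Defs
  imports "HOL-Analysis.Analysis" "HOL-Library.Function_Algebras" "HOL-Library.Extended_Nat"
begin

text \<open>Two-sided complex sequences as a complex vector space; addition is pointwise.\<close>

definition seq_scale :: "complex \<Rightarrow> (int \<Rightarrow> complex) \<Rightarrow> int \<Rightarrow> complex" where
  "seq_scale c u = (\<lambda>n. c * u n)"

interpretation cseq: vector_space seq_scale
  by unfold_locales (auto simp: seq_scale_def fun_eq_iff algebra_simps)

definition l2 :: "(int \<Rightarrow> complex) set" where
  "l2 = {u. (\<lambda>n. (cmod (u n))\<^sup>2) summable_on UNIV}"

text \<open>Replacing \<open>a n\<close> by \<open>- a n\<close> for some \<open>n\<close> gives a unitarily equivalent operator, so an upper bound
  on eigenvalues in terms of \<open>(a n - 1)\<^sub>+\<close> needs a lower bound on \<open>a\<close>: with \<open>b = 0\<close>, \<open>a 0 = -5\<close> and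
  \<open>a n = 1\<close> otherwise there are eigenvalues outside \<open>[-2, 2]\<close>. The usual convention for Jacobi
  matrices is \<open>a n > 0\<close>; the theorem assumes only \<open>a n \<ge> -1\<close>, which is the weakest pointwise
  bound for which the inequality holds.\<close>

definition jacobi :: "(int \<Rightarrow> real) \<Rightarrow> (int \<Rightarrow> real) \<Rightarrow> (int \<Rightarrow> complex) \<Rightarrow> int \<Rightarrow> complex" where
  "jacobi a b u = (\<lambda>n. of_real (a (n - 1)) * u (n - 1) + of_real (b n) * u n
                        + of_real (a n) * u (n + 1))"

definition eigenspace :: "((int \<Rightarrow> complex) \<Rightarrow> int \<Rightarrow> complex) \<Rightarrow> real \<Rightarrow> (int \<Rightarrow> complex) set" where
  "eigenspace J E = {u \<in> l2. J u = seq_scale (of_real E) u}"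

text \<open>The dimension of the eigenspace. The case distinction is needed because \<^const>\<open>cseq.dim\<close>
  does not tell infinite-dimensional spaces from the zero space.\<close>

definition multiplicity_eig :: "((int \<Rightarrow> complex) \<Rightarrow> int \<Rightarrow> complex) \<Rightarrow> real \<Rightarrow> enat" where
  "multiplicity_eig J E =
     (if \<exists>B. finite B \<and> cseq.span B = eigenspace J E
      then enat (cseq.dim (eigenspace J E)) else \<infinity>)"

text \<open>An eigenvalue \<open>E\<close> of multiplicity \<open>m\<close> is represented by the \<open>m\<close> pairs \<open>(E, k)\<close>
  with \<open>k < m\<close>, so that summation over these sets counts eigenvalues with multiplicity.
  Non-eigenvalues have multiplicity 0 and do not contribute.\<close>

definition eigs_plus :: "((int \<Rightarrow> complex) \<Rightarrow> int \<Rightarrow> complex) \<Rightarrow> (real \<times> nat) set" where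
  "eigs_plus J = {(E, k). E > 2 \<and> enat k < multiplicity_eig J E}"

definition eigs_minus :: "((int \<Rightarrow> complex) \<Rightarrow> int \<Rightarrow> complex) \<Rightarrow> (real \<times> nat) set" where
  "eigs_minus J = {(E, k). E < -2 \<and> enat k < multiplicity_eig J E}"

end

theory Submission
  imports Defs
begin

text \<open>
  Write an eigenvalue outside \<open>[-2, 2]\<close> as \<open>E = \<mu> + 1/\<mu>\<close> with \<open>0 < \<mu> < 1\<close>, so that
  \<open>sqrt (E\<^sup>2 - 4) = 1/\<mu> - \<mu>\<close> and the free resolvent has the kernel
  \<open>\<mu>\<^bsup>|m-n|\<^esup> / (1/\<mu> - \<mu>)\<close>. As quadratic forms \<open>J\<close> is at most \<open>J\<^sub>\<alpha> + C\<close>, where \<open>J\<^sub>\<alpha>\<close> has off-diagonal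
  entries \<open>\<alpha>\<^sub>n = min a\<^sub>n 1\<close> and no diagonal, and \<open>C\<close> is the diagonal matrix with entries
  \<open>c\<^sub>n = (b\<^sub>n)\<^sub>+ + (a\<^sub>n - 1)\<^sub>+ + (a\<^bsub>n-1\<^esub> - 1)\<^sub>+\<close>. The resolvent of \<open>J\<^sub>\<alpha>\<close> is at most
  \<open>G / (1/\<mu> - \<mu>)\<close>, where \<open>G\<close> is the kernel given by products of \<open>\<rho>\<^sub>l = \<mu> \<alpha>\<^sub>l\<close> over the edges between two sites;
  hence the Birman--Schwinger principle makes the \<open>k\<close>-th eigenvalue of \<open>L\<^sub>\<mu> = C\<^bsup>1/2\<^esup> G C\<^bsup>1/2\<^esup>\<close> at
  \<open>\<mu> = \<mu>\<^sub>k\<close> at least \<open>1/\<mu>\<^sub>k - \<mu>\<^sub>k\<close>. The sum of the \<open>k\<close> largest eigenvalues of \<open>L\<^sub>\<mu>\<close> increases with \<open>\<mu>\<close>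
  (Hundertmark, Lieb and Thomas), so with \<open>E\<^sub>1 \<ge> E\<^sub>2 \<ge> \<dots>\<close> the inequalities can be added one
  eigenvalue at a time, and the total is at most the trace \<open>\<Sum>c\<^sub>n\<close>. Truncating the eigenvectors to a
  window reduces all this to finite matrices, at the price of replacing \<open>E\<close> by \<open>E - \<delta>\<close>. The
  eigenvalues below \<open>-2\<close> are those above \<open>2\<close> for \<open>-b\<close>, after conjugation by \<open>(-1)\<^sup>n\<close>.
\<close>

section \<open>Products along a chain\<close>

definition chain_sum :: "nat \<Rightarrow> (nat \<Rightarrow> real) \<Rightarrow> (nat \<Rightarrow> complex) \<Rightarrow> nat \<Rightarrow> complex" where
  "chain_sum M \<rho> v j = (\<Sum>n\<in>{j..<M}. of_real (\<Prod>l\<in>{j..<n}. \<rho> l) * v n)"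

text \<open>The quadratic form of the kernel \<open>\<Prod>l\<in>{min m n..<max m n}. \<rho> l\<close>: each off-diagonal pair of sites occurs once in
  \<open>chain_sum\<close>, hence the factor 2, and the diagonal is then counted twice.\<close>

definition chain_form :: "nat \<Rightarrow> (nat \<Rightarrow> real) \<Rightarrow> (nat \<Rightarrow> complex) \<Rightarrow> real" where
  "chain_form M \<rho> v = (\<Sum>j<M. 2 * Re (cnj (v j) * chain_sum M \<rho> v j) - (cmod (v j))\<^sup>2)"

lemma chain_sum_end [simp]: "chain_sum M \<rho> v M = 0"
  by (simp add: chain_sum_def)

lemma chain_sum_rec:
  assumes "j < M"
  shows "chain_sum M \<rho> v j = v j + of_real (\<rho> j) * chain_sum M \<rho> v (Suc j)"
proof -
  have "(\<Prod>l\<in>{j..<n}. \<rho> l) = \<rho> j * (\<Prod>l\<in>{Suc j..<n}. \<rho> l)" if "n \<in> {Suc j..<M}" for n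
    using that by (subst prod.atLeast_Suc_lessThan) auto
  then show ?thesis
    using assms unfolding chain_sum_def
    by (subst sum.atLeast_Suc_lessThan) (auto simp: sum_distrib_left mult.assoc intro!: sum.cong)
qed

text \<open>By \<open>chain_sum_rec\<close>, \<open>\<rho> j\<close> times the tail at
  \<open>Suc j\<close> is the tail at \<open>j\<close> minus \<open>v j\<close>; expanding its
  squared modulus turns each summand of the form into a difference of two squares. For |\<rho>|
  \<le> 1 all coefficients are nonnegative, and every square is that of a linear functional of
  \<open>v\<close>; this serves both the trace bound and the Birman-Schwinger estimate.\<close>

lemma chain_form_squares:
  "chain_form (Suc m) \<rho> v = (cmod (chain_sum (Suc m) \<rho> v 0))\<^sup>2
     + (\<Sum>j<m. (1 - (\<rho> j)\<^sup>2) * (cmod (chain_sum (Suc m) \<rho> v (Suc j)))\<^sup>2)"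
proof -
  let ?T = "chain_sum (Suc m) \<rho> v"
  have *: "2 * Re (cnj (v j) * ?T j) - (cmod (v j))\<^sup>2
      = (cmod (?T j))\<^sup>2 - (\<rho> j)\<^sup>2 * (cmod (?T (Suc j)))\<^sup>2" if "j < Suc m" for j
  proof -
    have "(\<rho> j)\<^sup>2 * (cmod (?T (Suc j)))\<^sup>2 = (cmod (?T j - v j))\<^sup>2"
      using chain_sum_rec[OF that, of \<rho> v] by (simp add: norm_mult power_mult_distrib)
    also have "\<dots> = (cmod (?T j))\<^sup>2 + (cmod (v j))\<^sup>2 - 2 * Re (cnj (v j) * ?T j)"
      by (simp only: cmod_power2) (simp add: power2_eq_square algebra_simps)
    finally show ?thesis by simp
  qed
  have "chain_form (Suc m) \<rho> v
      = (\<Sum>j<Suc m. (cmod (?T j))\<^sup>2) - (\<Sum>j<Suc m. (\<rho> j)\<^sup>2 * (cmod (?T (Suc j)))\<^sup>2)"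
    unfolding chain_form_def sum_subtractf[symmetric] by (rule sum.cong) (use * in auto)
  also have "(\<Sum>j<Suc m. (cmod (?T j))\<^sup>2) = (cmod (?T 0))\<^sup>2 + (\<Sum>j<m. (cmod (?T (Suc j)))\<^sup>2)"
    by (rule sum.lessThan_Suc_shift)
  also have "(\<Sum>j<Suc m. (\<rho> j)\<^sup>2 * (cmod (?T (Suc j)))\<^sup>2) = (\<Sum>j<m. (\<rho> j)\<^sup>2 * (cmod (?T (Suc j)))\<^sup>2)"
    by simp
  finally show ?thesis
    by (simp add: left_diff_distrib sum_subtractf)
qed

lemma chain_sum_scale: "chain_sum M \<rho> (\<lambda>n. c * v n) j = c * chain_sum M \<rho> v j"
  by (simp add: chain_sum_def sum_distrib_left mult_ac)

lemma chain_form_scale: "chain_form M \<rho> (\<lambda>n. c * v n) = (cmod c)\<^sup>2 * chain_form M \<rho> v"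
proof -
  have re: "Re (cnj (c * v j) * (c * t)) = (cmod c)\<^sup>2 * Re (cnj (v j) * t)" for j t
  proof -
    have "cnj (c * v j) * (c * t) = of_real ((cmod c)\<^sup>2) * (cnj (v j) * t)"
      by (simp only: complex_norm_square complex_cnj_mult mult_ac)
    then have "Re (cnj (c * v j) * (c * t)) = Re (of_real ((cmod c)\<^sup>2) * (cnj (v j) * t))"
      by (rule arg_cong)
    then show ?thesis by (simp only: Re_complex_of_real Im_complex_of_real times_complex.sel mult_zero_left diff_zero)
  qed
  show ?thesis
    unfolding chain_form_def chain_sum_scale sum_distrib_left
    by (intro sum.cong refl)
      (simp only: re norm_mult power_mult_distrib right_diff_distrib)
qed

text \<open>A product over a range of edges contains the edge \<open>l\<close> at most once.
  \<open>p\<close> collects the ranges that avoid \<open>l\<close>, and \<open>q\<close> the others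
  with the factor at \<open>l\<close> removed.\<close>

lemma chain_form_affine: "\<exists>A B. \<forall>x. chain_form M (\<rho>(l := x)) v = A + B * x"
proof -
  define p where "p j n = (if l \<in> {j..<n} then 0 else \<Prod>i\<in>{j..<n}. \<rho> i)" for j n
  define q where "q j n = (if l \<in> {j..<n} then \<Prod>i\<in>{j..<n} - {l}. \<rho> i else 0)" for j n
  have pq: "(\<Prod>i\<in>{j..<n}. (\<rho>(l := x)) i) = p j n + q j n * x" for j n x
  proof (cases "l \<in> {j..<n}")
    case True
    then have "(\<Prod>i\<in>{j..<n}. (\<rho>(l := x)) i) = x * (\<Prod>i\<in>{j..<n} - {l}. (\<rho>(l := x)) i)"
      by (subst prod.remove[of _ l]) auto
    also have "(\<Prod>i\<in>{j..<n} - {l}. (\<rho>(l := x)) i) = (\<Prod>i\<in>{j..<n} - {l}. \<rho> i)"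
      by (rule prod.cong) auto
    finally show ?thesis using True by (simp add: p_def q_def)
  next
    case False
    then have "(\<Prod>i\<in>{j..<n}. (\<rho>(l := x)) i) = (\<Prod>i\<in>{j..<n}. \<rho> i)"
      by (intro prod.cong) auto
    then show ?thesis using False by (simp only: p_def q_def if_False mult_zero_left add_0_right)
  qed
  define P where "P j = (\<Sum>n\<in>{j..<M}. of_real (p j n) * v n)" for j
  define Q where "Q j = (\<Sum>n\<in>{j..<M}. of_real (q j n) * v n)" for j
  have T: "chain_sum M (\<rho>(l := x)) v j = P j + of_real x * Q j" for x j
    unfolding chain_sum_def pq P_def Q_def
    by (simp add: sum.distrib sum_distrib_left algebra_simps)
  have "chain_form M (\<rho>(l := x)) v = (\<Sum>j<M. 2 * Re (cnj (v j) * P j) - (cmod (v j))\<^sup>2)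
      + (\<Sum>j<M. 2 * Re (cnj (v j) * Q j)) * x" for x
    unfolding chain_form_def T sum_distrib_right sum.distrib[symmetric]
    by (rule sum.cong) (auto simp: algebra_simps)
  then show ?thesis by blast
qed

text \<open>Conjugation by the diagonal signs \<open>\<eta>\<close>: for j \<le> n,
  \<open>\<eta> j * \<eta> n\<close> is -1 exactly when the edge \<open>l\<close> lies between the
  two sites, that is, when the product contains \<open>\<rho> l\<close>.\<close>

lemma chain_form_flip:
  "chain_form M (\<rho>(l := - \<rho> l)) v = chain_form M \<rho> (\<lambda>n. if n \<le> l then v n else - v n)"
proof -
  define \<eta> :: "nat \<Rightarrow> complex" where "\<eta> n = (if n \<le> l then 1 else -1)" for n
  have pr: "of_real (\<Prod>i\<in>{j..<n}. (\<rho>(l := - \<rho> l)) i) = \<eta> j * \<eta> n * of_real (\<Prod>i\<in>{j..<n}. \<rho> i)"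
    if "j \<le> n" for j n
  proof (cases "l \<in> {j..<n}")
    case True
    have "(\<Prod>i\<in>{j..<n}. (\<rho>(l := - \<rho> l)) i) = - \<rho> l * (\<Prod>i\<in>{j..<n} - {l}. (\<rho>(l := - \<rho> l)) i)"
      using True by (subst prod.remove[of _ l]) auto
    also have "(\<Prod>i\<in>{j..<n} - {l}. (\<rho>(l := - \<rho> l)) i) = (\<Prod>i\<in>{j..<n} - {l}. \<rho> i)"
      by (rule prod.cong) auto
    also have "- \<rho> l * \<dots> = - (\<Prod>i\<in>{j..<n}. \<rho> i)"
      using True by (subst (2) prod.remove[of _ l]) auto
    finally show ?thesis using True by (simp add: \<eta>_def del: fun_upd_apply)
  next
    case False
    then have "(\<Prod>i\<in>{j..<n}. (\<rho>(l := - \<rho> l)) i) = (\<Prod>i\<in>{j..<n}. \<rho> i)"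
      by (intro prod.cong) auto
    moreover have "\<eta> j * \<eta> n = 1" using False that by (auto simp: \<eta>_def)
    ultimately show ?thesis by (simp only: mult_1_left)
  qed
  let ?v = "\<lambda>n. if n \<le> l then v n else - v n"
  have v: "?v n = \<eta> n * v n" for n by (simp add: \<eta>_def)
  have T: "chain_sum M (\<rho>(l := - \<rho> l)) v j = \<eta> j * chain_sum M \<rho> ?v j" for j
    unfolding chain_sum_def sum_distrib_left
    by (rule sum.cong) (simp_all add: pr v mult_ac del: fun_upd_apply of_real_prod)
  show ?thesis
    unfolding chain_form_def T by (rule sum.cong) (auto simp: \<eta>_def)
qed

section \<open>Traces over orthonormal frames\<close>

definition orthonormal_frame :: "nat \<Rightarrow> nat \<Rightarrow> (nat \<Rightarrow> nat \<Rightarrow> complex) \<Rightarrow> bool" where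
  "orthonormal_frame M k x \<longleftrightarrow>
     (\<forall>i<k. \<forall>j<k. (\<Sum>n<M. cnj (x i n) * x j n) = (if i = j then 1 else 0))"

text \<open>The trace of the compression to the span of the frame of the kernel weighted by
  \<open>d\<close> on both sides. By Ky Fan's principle its maximum over frames, for k \<le> M, is
  the sum of the \<open>k\<close> largest eigenvalues, so exhibiting frames replaces
  diagonalization.\<close>

definition frame_trace ::
  "nat \<Rightarrow> (nat \<Rightarrow> real) \<Rightarrow> (nat \<Rightarrow> real) \<Rightarrow> nat \<Rightarrow> (nat \<Rightarrow> nat \<Rightarrow> complex) \<Rightarrow> real" where
  "frame_trace M d \<rho> k x = (\<Sum>i<k. chain_form M \<rho> (\<lambda>n. of_real (d n) * x i n))"

text \<open>The trace is affine in each \<open>\<rho> l\<close>, hence at most its value at \<open>r\<close> or at \<open>- r\<close>; the sign is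
  removed by negating all vectors to the right of the edge \<open>l\<close>.\<close>

lemma frame_trace_mono_single:
  assumes x: "orthonormal_frame M k x" and r: "\<bar>\<rho> l\<bar> \<le> \<bar>r\<bar>"
  shows "\<exists>x'. orthonormal_frame M k x' \<and> frame_trace M d \<rho> k x \<le> frame_trace M d (\<rho>(l := r)) k x'"
proof -
  have "\<forall>i. \<exists>A B. \<forall>t. chain_form M (\<rho>(l := t)) (\<lambda>n. of_real (d n) * x i n) = A + B * t"
    by (intro allI chain_form_affine)
  then obtain A B where "\<And>i t. chain_form M (\<rho>(l := t)) (\<lambda>n. of_real (d n) * x i n) = A i + B i * t"
    by metis
  then have aff: "frame_trace M d (\<rho>(l := t)) k x = (\<Sum>i<k. A i) + (\<Sum>i<k. B i) * t" for t
    by (simp add: frame_trace_def sum.distrib sum_distrib_right)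
  have self: "frame_trace M d \<rho> k x = (\<Sum>i<k. A i) + (\<Sum>i<k. B i) * \<rho> l"
    using aff[of "\<rho> l"] by simp
  have "(\<Sum>i<k. B i) * \<rho> l \<le> \<bar>\<Sum>i<k. B i\<bar> * \<bar>r\<bar>"
    using mult_left_mono[OF r, of "\<bar>\<Sum>i<k. B i\<bar>"] abs_ge_self[of "(\<Sum>i<k. B i) * \<rho> l"]
    by (simp add: abs_mult)
  also have "\<dots> = \<bar>(\<Sum>i<k. B i) * r\<bar>" by (simp add: abs_mult)
  finally have "(\<Sum>i<k. B i) * \<rho> l \<le> (\<Sum>i<k. B i) * r \<or> (\<Sum>i<k. B i) * \<rho> l \<le> (\<Sum>i<k. B i) * (- r)"
    by (auto simp: abs_if split: if_splits)
  then consider "frame_trace M d \<rho> k x \<le> frame_trace M d (\<rho>(l := r)) k x"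
    | "frame_trace M d \<rho> k x \<le> frame_trace M d (\<rho>(l := - r)) k x"
    unfolding self aff by auto
  then show ?thesis
  proof cases
    case 1
    with x show ?thesis by blast
  next
    case 2
    define x' where "x' i n = (if n \<le> l then x i n else - x i n)" for i n
    have "orthonormal_frame M k x'"
    proof -
      have "(\<Sum>n<M. cnj (x' i n) * x' j n) = (\<Sum>n<M. cnj (x i n) * x j n)" for i j
        by (rule sum.cong) (auto simp: x'_def)
      with x show ?thesis by (simp add: orthonormal_frame_def)
    qed
    moreover have "frame_trace M d (\<rho>(l := - r)) k x = frame_trace M d (\<rho>(l := r)) k x'"
    proof -
      have "chain_form M (\<rho>(l := - r)) (\<lambda>n. of_real (d n) * x i n)
          = chain_form M (\<rho>(l := r)) (\<lambda>n. of_real (d n) * x' i n)" for i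
        using chain_form_flip[of M "\<rho>(l := r)" l "\<lambda>n. of_real (d n) * x i n"]
        by (simp add: x'_def if_distrib[of "\<lambda>z. of_real (d _) * z"] cong: if_cong)
      then show ?thesis by (simp add: frame_trace_def)
    qed
    ultimately show ?thesis using 2 by auto
  qed
qed

lemma chain_form_cong:
  assumes "\<And>l. l < M \<Longrightarrow> \<rho> l = \<rho>' l" "\<And>n. n < M \<Longrightarrow> v n = v' n"
  shows "chain_form M \<rho> v = chain_form M \<rho>' v'"
proof -
  have "chain_sum M \<rho> v j = chain_sum M \<rho>' v' j" for j
    unfolding chain_sum_def using assms
    by (intro sum.cong arg_cong2[where f = "(*)"] arg_cong[where f = of_real] prod.cong) auto
  then show ?thesis
    unfolding chain_form_def using assms by (intro sum.cong) auto
qed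

text \<open>The monotonicity of the sum of the \<open>k\<close> largest eigenvalues. The weights are
  replaced one edge at a time. The frame may change at every edge, which is harmless because only
  the maximum over frames matters.\<close>

lemma frame_trace_mono:
  assumes x: "orthonormal_frame M k x" and r: "\<And>l. l < M \<Longrightarrow> \<bar>\<rho> l\<bar> \<le> \<bar>r l\<bar>"
  shows "\<exists>x'. orthonormal_frame M k x' \<and> frame_trace M d \<rho> k x \<le> frame_trace M d r k x'"
proof -
  have "\<exists>x'. orthonormal_frame M k x' \<and>
      frame_trace M d \<rho> k x \<le> frame_trace M d (\<lambda>i. if i < l then r i else \<rho> i) k x'" if "l \<le> M" for l
    using that
  proof (induction l)
    case 0
    then show ?case using x by auto
  next
    case (Suc l)
    then obtain y where y: "orthonormal_frame M k y"
      "frame_trace M d \<rho> k x \<le> frame_trace M d (\<lambda>i. if i < l then r i else \<rho> i) k y"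
      by auto
    have upd: "(\<lambda>i. if i < l then r i else \<rho> i)(l := r l) = (\<lambda>i. if i < Suc l then r i else \<rho> i)"
      by (auto simp: fun_eq_iff less_Suc_eq)
    have "\<bar>(\<lambda>i. if i < l then r i else \<rho> i) l\<bar> \<le> \<bar>r l\<bar>" using r Suc.prems by simp
    from frame_trace_mono_single[where \<rho> = "\<lambda>i. if i < l then r i else \<rho> i", OF y(1) this, where d = d]
    obtain y' where "orthonormal_frame M k y'"
      "frame_trace M d (\<lambda>i. if i < l then r i else \<rho> i) k y
        \<le> frame_trace M d (\<lambda>i. if i < Suc l then r i else \<rho> i) k y'"
      unfolding upd by blast
    with y show ?case by (meson order_trans)
  qed
  from this[of M] obtain x' where x': "orthonormal_frame M k x'"
    "frame_trace M d \<rho> k x \<le> frame_trace M d (\<lambda>i. if i < M then r i else \<rho> i) k x'" by auto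
  moreover have "frame_trace M d (\<lambda>i. if i < M then r i else \<rho> i) k x' = frame_trace M d r k x'"
    unfolding frame_trace_def by (intro sum.cong chain_form_cong) auto
  ultimately show ?thesis by auto
qed

lemma bessel_frame:
  assumes "orthonormal_frame M k x"
  shows "(\<Sum>i<k. (cmod (\<Sum>n<M. cnj (y n) * x i n))\<^sup>2) \<le> (\<Sum>n<M. (cmod (y n))\<^sup>2)"
proof -
  \<comment> \<open>\<open>p\<close> is the orthogonal projection of \<open>y\<close> to the span of
    the frame. Its inner product with \<open>y\<close> and its squared norm are both
    \<open>\<Sum>i<k. (cmod (t i))\<^sup>2\<close>, so the claim is that y - p has nonnegative
    squared norm.\<close>
  define t where "t i = (\<Sum>n<M. cnj (x i n) * y n)" for i
  define p where "p n = (\<Sum>i<k. t i * x i n)" for n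
  have ct: "cnj (t i) = (\<Sum>n<M. cnj (y n) * x i n)" for i
    unfolding t_def by (simp add: mult_ac)
  have py: "(\<Sum>n<M. cnj (p n) * y n) = of_real (\<Sum>i<k. (cmod (t i))\<^sup>2)"
  proof -
    have "(\<Sum>n<M. cnj (p n) * y n) = (\<Sum>n<M. \<Sum>i<k. cnj (t i) * (cnj (x i n) * y n))"
      unfolding p_def by (simp add: sum_distrib_left sum_distrib_right mult_ac)
    also have "\<dots> = (\<Sum>i<k. cnj (t i) * t i)"
      by (subst sum.swap) (simp add: t_def sum_distrib_left)
    finally show ?thesis by (simp add: complex_norm_square mult_ac del: of_real_power)
  qed
  have pp: "(\<Sum>n<M. cnj (p n) * p n) = of_real (\<Sum>i<k. (cmod (t i))\<^sup>2)"
  proof -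
    have "(\<Sum>n<M. cnj (p n) * p n)
        = (\<Sum>n<M. \<Sum>i<k. \<Sum>j<k. cnj (t i) * (t j * (cnj (x i n) * x j n)))"
      unfolding p_def cnj_sum sum_product by (intro sum.cong refl) (simp add: mult_ac)
    also have "\<dots> = (\<Sum>i<k. \<Sum>j<k. cnj (t i) * (t j * (\<Sum>n<M. cnj (x i n) * x j n)))"
      unfolding sum_distrib_left
      by (rule trans[OF sum.swap sum.cong[OF refl sum.swap]])
    also have "\<dots> = (\<Sum>i<k. \<Sum>j<k. cnj (t i) * (t j * (if i = j then 1 else 0)))"
      using assms by (intro sum.cong) (auto simp: orthonormal_frame_def)
    also have "\<dots> = (\<Sum>i<k. cnj (t i) * t i)"
      by (intro sum.cong refl) (simp add: if_distrib cong: if_cong)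
    finally show ?thesis by (simp add: complex_norm_square mult_ac del: of_real_power)
  qed
  have "0 \<le> (\<Sum>n<M. (cmod (y n - p n))\<^sup>2)" by (simp add: sum_nonneg)
  also have "(\<Sum>n<M. (cmod (y n - p n))\<^sup>2)
      = (\<Sum>n<M. (cmod (y n))\<^sup>2 + Re (cnj (p n) * p n) - 2 * Re (cnj (p n) * y n))"
    by (intro sum.cong refl) (simp only: cmod_power2, simp add: power2_eq_square algebra_simps)
  also have "\<dots> = (\<Sum>n<M. (cmod (y n))\<^sup>2) + Re (\<Sum>n<M. cnj (p n) * p n) - 2 * Re (\<Sum>n<M. cnj (p n) * y n)"
    by (simp add: sum.distrib sum_subtractf sum_distrib_left)
  also have "\<dots> = (\<Sum>n<M. (cmod (y n))\<^sup>2) - (\<Sum>i<k. (cmod (cnj (t i)))\<^sup>2)"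
    unfolding pp py by simp
  finally show ?thesis unfolding ct by simp
qed

text \<open>\<open>chain_form_squares\<close> gives squares of linear functionals with nonnegative
  coefficients. Over a frame, Bessel's inequality bounds the sum of each square by the squared norm
  of the functional, which is the same sum over the standard basis, where \<open>e n\<close> is the
  \<open>n\<close>-th basis vector multiplied by \<open>d n\<close>. The bound is therefore the full
  trace, and the kernel is 1 on the diagonal.\<close>

lemma frame_trace_le:
  assumes x: "orthonormal_frame (Suc m) k x" and \<rho>: "\<And>l. l < m \<Longrightarrow> \<bar>\<rho> l\<bar> \<le> 1"
  shows "frame_trace (Suc m) d \<rho> k x \<le> (\<Sum>n<Suc m. (d n)\<^sup>2)"
proof -
  let ?T = "chain_sum (Suc m) \<rho>"
  define e where "e n i = (if i = n then of_real (d n) else (0::complex))" for n i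
  have Te: "?T (e n) j = (if j \<le> n then of_real ((\<Prod>l\<in>{j..<n}. \<rho> l) * d n) else 0)" if "n < Suc m" for n j
    using that unfolding chain_sum_def e_def
    by (simp add: if_distrib[of "\<lambda>z. _ * z"] cong: if_cong)
  have T: "(\<Sum>i<k. (cmod (?T (\<lambda>n. of_real (d n) * x i n) j))\<^sup>2) \<le> (\<Sum>n<Suc m. (cmod (?T (e n) j))\<^sup>2)" for j
  proof -
    have "?T (\<lambda>n. of_real (d n) * x i n) j = (\<Sum>n<Suc m. cnj (?T (e n) j) * x i n)" for i
    proof -
      have "?T (\<lambda>n. of_real (d n) * x i n) j
          = (\<Sum>n\<in>{j..<Suc m}. cnj (?T (e n) j) * x i n)"
        unfolding chain_sum_def[of _ _ "\<lambda>n. of_real (d n) * x i n"]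
        by (rule sum.cong) (auto simp: Te mult_ac)
      also have "\<dots> = (\<Sum>n<Suc m. cnj (?T (e n) j) * x i n)"
        by (rule sum.mono_neutral_left) (auto simp: Te)
      finally show ?thesis .
    qed
    then show ?thesis using bessel_frame[OF x, of "\<lambda>n. ?T (e n) j"] by simp
  qed
  have nn: "0 \<le> 1 - (\<rho> j)\<^sup>2" if "j < m" for j
    using \<rho>[OF that] by (simp add: abs_square_le_1)
  have "frame_trace (Suc m) d \<rho> k x
      = (\<Sum>i<k. (cmod (?T (\<lambda>n. of_real (d n) * x i n) 0))\<^sup>2)
       + (\<Sum>j<m. (1 - (\<rho> j)\<^sup>2) * (\<Sum>i<k. (cmod (?T (\<lambda>n. of_real (d n) * x i n) (Suc j)))\<^sup>2))"
    unfolding frame_trace_def chain_form_squares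
    by (simp add: sum.distrib sum_distrib_left) (rule sum.swap)
  also have "\<dots> \<le> (\<Sum>n<Suc m. (cmod (?T (e n) 0))\<^sup>2)
       + (\<Sum>j<m. (1 - (\<rho> j)\<^sup>2) * (\<Sum>n<Suc m. (cmod (?T (e n) (Suc j)))\<^sup>2))"
    by (intro add_mono sum_mono mult_left_mono T nn) auto
  also have "\<dots> = (\<Sum>n<Suc m. chain_form (Suc m) \<rho> (e n))"
    unfolding chain_form_squares by (simp only: sum.distrib sum_distrib_left) (rule arg_cong2[where f = "(+)", OF refl sum.swap])
  also have "\<dots> = (\<Sum>n<Suc m. (d n)\<^sup>2)"
  proof (rule sum.cong)
    fix n assume n: "n \<in> {..<Suc m}"
    have "chain_form (Suc m) \<rho> (e n) = (\<Sum>j<Suc m. if j = n then (d n)\<^sup>2 else 0)"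
      unfolding chain_form_def by (rule sum.cong) (use n in \<open>auto simp: Te, auto simp: e_def power2_eq_square\<close>)
    then show "chain_form (Suc m) \<rho> (e n) = (d n)\<^sup>2" using n by simp
  qed simp
  finally show ?thesis .
qed

section \<open>The inequality for finite chains\<close>

lemma homogeneous_system_nontrivial:
  fixes f :: "'i \<Rightarrow> 'j \<Rightarrow> 'k::field"
  assumes "finite I" "finite J" "card I < card J"
  shows "\<exists>z. (\<exists>j\<in>J. z j \<noteq> 0) \<and> (\<forall>i\<in>I. (\<Sum>j\<in>J. z j * f i j) = 0)"
  using assms
proof (induction I arbitrary: J f)
  case empty
  then obtain j where "j \<in> J" by (metis card_gt_0_iff card.empty ex_in_conv)
  then show ?case by (intro exI[of _ "\<lambda>_. 1"]) auto
next
  case (insert i I)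
  show ?case
  proof (cases "\<forall>j\<in>J. f i j = 0")
    case True
    have "card I < card J" using insert.prems insert.hyps by simp
    from insert.IH[OF insert.prems(1) this, of f] True show ?thesis by auto
  next
    case False
    then obtain p where p: "p \<in> J" "f i p \<noteq> 0" by auto
    \<comment> \<open>Gaussian elimination: \<open>g\<close> is the coefficient matrix after
      equation \<open>i\<close> has been solved for the unknown \<open>p\<close>; below,
      \<open>y\<close> recovers this unknown from a solution of the smaller system.\<close>
    define g where "g i' j = f i' j - f i' p * f i j / f i p" for i' j
    have "card I < card (J - {p})" using insert p by simp
    with insert.IH[of "J - {p}" g] insert.prems obtain z where z: "\<exists>j\<in>J - {p}. z j \<noteq> 0"
      "\<forall>i\<in>I. (\<Sum>j\<in>J - {p}. z j * g i j) = 0" by auto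
    define y where "y = z(p := - (\<Sum>j\<in>J - {p}. z j * f i j) / f i p)"
    have y: "(\<Sum>j\<in>J. y j * f i' j) = y p * f i' p + (\<Sum>j\<in>J - {p}. z j * f i' j)" for i'
    proof -
      have "(\<Sum>j\<in>J - {p}. y j * f i' j) = (\<Sum>j\<in>J - {p}. z j * f i' j)"
        by (rule sum.cong) (auto simp: y_def)
      then show ?thesis using p insert.prems by (simp add: sum.remove)
    qed
    have "(\<Sum>j\<in>J. y j * f i j) = 0" unfolding y using p by (simp add: y_def)
    moreover have "(\<Sum>j\<in>J. y j * f i' j) = 0" if "i' \<in> I" for i'
    proof -
      have "(\<Sum>j\<in>J - {p}. z j * f i' j) - f i' p / f i p * (\<Sum>j\<in>J - {p}. z j * f i j)
          = (\<Sum>j\<in>J - {p}. z j * g i' j)"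
        by (simp add: g_def sum_distrib_left right_diff_distrib sum_subtractf mult_ac)
      also have "\<dots> = 0" using z(2) that by blast
      finally show ?thesis unfolding y by (simp add: y_def)
    qed
    moreover have "\<exists>j\<in>J. y j \<noteq> 0" using z(1) by (auto simp: y_def)
    ultimately show ?thesis by blast
  qed
qed

text \<open>The inverse of the kernel of \<open>chain_form\<close> is tridiagonal, and its quadratic form is, up to an end term, a sum over edges of
  the terms on the left. The inequality compares it edge by edge with \<open>\<mu> + 1/\<mu> - J\<^sub>\<alpha>\<close>; the
  difference is \<open>\<mu> (1 - \<alpha>\<^sup>2) / (1 - (\<mu> \<alpha>)\<^sup>2)\<close> times a positive form.\<close>

lemma edge_inequality:
  fixes x y :: complex
  assumes \<mu>: "0 < \<mu>" "\<mu> < 1" and \<alpha>: "\<bar>\<alpha>\<bar> \<le> 1"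
  defines "s \<equiv> 1 / \<mu> - \<mu>"
  shows "s * (cmod (y - of_real (\<mu> * \<alpha>) * x))\<^sup>2 / (1 - (\<mu> * \<alpha>)\<^sup>2)
    \<le> s * (cmod y)\<^sup>2 + \<mu> * (cmod x)\<^sup>2 + \<mu> * (cmod y)\<^sup>2 - 2 * \<alpha> * Re (cnj x * y)"
proof -
  define \<rho> where "\<rho> = \<mu> * \<alpha>"
  define X Y Z where "X = (cmod x)\<^sup>2" and "Y = (cmod y)\<^sup>2" and "Z = Re (cnj x * y)"
  have "\<bar>\<rho>\<bar> \<le> \<mu>" unfolding \<rho>_def abs_mult using \<mu> mult_left_mono[OF \<alpha>, of \<mu>] by simp
  then have \<rho>: "\<bar>\<rho>\<bar> < 1" using \<mu> by simp
  then have \<rho>2: "0 < 1 - \<rho>\<^sup>2" by (simp add: abs_square_less_1)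
  have \<alpha>2: "0 \<le> 1 - \<alpha>\<^sup>2" using \<alpha> by (simp add: abs_square_le_1)
  have "2 * \<bar>Z\<bar> \<le> X + Y"
  proof -
    have "\<bar>Z\<bar> \<le> cmod x * cmod y"
      unfolding Z_def using abs_Re_le_cmod[of "cnj x * y"] by (simp add: norm_mult)
    moreover have "0 \<le> (cmod x - cmod y)\<^sup>2" by simp
    ultimately show ?thesis unfolding X_def Y_def by (simp add: power2_diff)
  qed
  moreover have "2 * \<rho> * Z \<le> 2 * \<bar>Z\<bar>"
    using \<rho> mult_right_mono[of "\<bar>\<rho>\<bar>" 1 "\<bar>Z\<bar>"] abs_ge_self[of "\<rho> * Z"] by (simp add: abs_mult)
  ultimately have pos: "0 \<le> X + Y - 2 * \<rho> * Z" by simp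
  have sq: "(cmod (y - of_real \<rho> * x))\<^sup>2 = Y + \<rho>\<^sup>2 * X - 2 * \<rho> * Z"
    unfolding X_def Y_def Z_def by (simp only: cmod_power2) (simp add: power2_eq_square algebra_simps)
  have "(s * Y + \<mu> * X + \<mu> * Y - 2 * \<alpha> * Z) * (1 - \<rho>\<^sup>2) - s * (Y + \<rho>\<^sup>2 * X - 2 * \<rho> * Z)
      = \<mu> * (1 - \<alpha>\<^sup>2) * (X + Y - 2 * \<rho> * Z)"
    using \<mu> unfolding s_def \<rho>_def by (simp add: field_simps power2_eq_square)
  also have "\<dots> \<ge> 0" using \<mu> \<alpha>2 pos by simp
  finally have "s * (Y + \<rho>\<^sup>2 * X - 2 * \<rho> * Z) \<le> (s * Y + \<mu> * X + \<mu> * Y - 2 * \<alpha> * Z) * (1 - \<rho>\<^sup>2)" by simp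
  then have "s * (cmod (y - of_real \<rho> * x))\<^sup>2 / (1 - \<rho>\<^sup>2) \<le> s * Y + \<mu> * X + \<mu> * Y - 2 * \<alpha> * Z"
    unfolding sq using \<rho>2 by (simp add: pos_divide_le_eq)
  then show ?thesis unfolding X_def Y_def Z_def \<rho>_def .
qed

lemma young_cmod:
  fixes p t :: complex
  assumes "0 < \<tau>"
  shows "2 * Re (cnj p * t) \<le> \<tau> * (cmod p)\<^sup>2 + (cmod t)\<^sup>2 / \<tau>"
proof -
  have "0 \<le> (\<tau> * cmod p - cmod t)\<^sup>2 / \<tau>" using assms by simp
  also have "\<dots> = \<tau> * (cmod p)\<^sup>2 + (cmod t)\<^sup>2 / \<tau> - 2 * (cmod p * cmod t)"
    using assms by (simp add: field_simps power2_eq_square)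
  finally show ?thesis
    using complex_Re_le_cmod[of "cnj p * t"] by (simp add: norm_mult)
qed

text \<open>A duality argument that inverts no matrix. Let \<open>W\<close> be the sum on the right
  of \<open>form\<close>, and \<open>Q\<close> the form of the inverse kernel multiplied by
  \<open>s\<close>. The edge inequality and \<open>form\<close> give 0 \<le> Q < W. Pairing
  \<open>u\<close> with \<open>v\<close> and applying Young's inequality bounds 2 W by
  \<open>Q\<close> plus the chain form divided by \<open>s\<close>; subtracting Q < W leaves the
  claim.\<close>

lemma birman_schwinger_chain:
  fixes u :: "nat \<Rightarrow> complex" and c \<alpha> :: "nat \<Rightarrow> real"
  assumes \<mu>: "0 < \<mu>" "\<mu> < 1" and \<alpha>: "\<And>n. \<bar>\<alpha> n\<bar> \<le> 1"
  defines "s \<equiv> 1 / \<mu> - \<mu>"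
  assumes form: "(\<mu> + 1 / \<mu>) * (\<Sum>n<Suc m. (cmod (u n))\<^sup>2)
      - 2 * (\<Sum>n<m. \<alpha> n * Re (cnj (u n) * u (Suc n))) < (\<Sum>n<Suc m. c n * (cmod (u n))\<^sup>2)"
  shows "0 < (\<Sum>n<Suc m. c n * (cmod (u n))\<^sup>2)"
    and "s * (\<Sum>n<Suc m. c n * (cmod (u n))\<^sup>2)
      \<le> chain_form (Suc m) (\<lambda>n. \<mu> * \<alpha> n) (\<lambda>n. of_real (c n) * u n)"
proof -
  define W where "W = (\<Sum>n<Suc m. c n * (cmod (u n))\<^sup>2)"
  define \<rho> where "\<rho> n = \<mu> * \<alpha> n" for n
  define v where "v n = of_real (c n) * u n" for n
  define D where "D n = u (Suc n) - of_real (\<rho> n) * u n" for n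
  let ?T = "chain_sum (Suc m) \<rho> v"
  define Q where "Q = s * (cmod (u 0))\<^sup>2 + (\<Sum>n<m. s * (cmod (D n))\<^sup>2 / (1 - (\<rho> n)\<^sup>2))"
  have "1 < 1 / \<mu>" using \<mu> by simp
  then have s: "0 < s" unfolding s_def using \<mu> by linarith
  have \<rho>2: "0 < 1 - (\<rho> n)\<^sup>2" for n
  proof -
    have "\<bar>\<rho> n\<bar> \<le> \<mu>" unfolding \<rho>_def abs_mult using \<mu> mult_left_mono[OF \<alpha>, of \<mu>] by simp
    then show ?thesis using \<mu> by (simp add: abs_square_less_1)
  qed
  have "Q \<le> s * (cmod (u 0))\<^sup>2 + (\<Sum>n<m. s * (cmod (u (Suc n)))\<^sup>2 + \<mu> * (cmod (u n))\<^sup>2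
      + \<mu> * (cmod (u (Suc n)))\<^sup>2 - 2 * \<alpha> n * Re (cnj (u n) * u (Suc n)))"
    unfolding Q_def D_def \<rho>_def s_def by (intro add_left_mono sum_mono edge_inequality \<mu> \<alpha>)
  also have "\<dots> = s * (\<Sum>n<Suc m. (cmod (u n))\<^sup>2) + \<mu> * (\<Sum>n<m. (cmod (u n))\<^sup>2)
      + \<mu> * (\<Sum>n<m. (cmod (u (Suc n)))\<^sup>2) - 2 * (\<Sum>n<m. \<alpha> n * Re (cnj (u n) * u (Suc n)))"
    by (simp only: sum.lessThan_Suc_shift[of _ m] sum.distrib sum_subtractf sum_distrib_left mult.assoc distrib_left)
  \<comment> \<open>Each end site has only one adjacent edge. Adding the missing term there gives
    every site the coefficient s + 2 \<mu> = \<mu> + 1/\<mu>.\<close>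
  also have "\<dots> \<le> s * (\<Sum>n<Suc m. (cmod (u n))\<^sup>2) + \<mu> * (\<Sum>n<Suc m. (cmod (u n))\<^sup>2)
      + \<mu> * (\<Sum>n<Suc m. (cmod (u n))\<^sup>2) - 2 * (\<Sum>n<m. \<alpha> n * Re (cnj (u n) * u (Suc n)))"
  proof -
    have "(\<Sum>n<m. (cmod (u n))\<^sup>2) \<le> (\<Sum>n<Suc m. (cmod (u n))\<^sup>2)" by simp
    moreover have "(\<Sum>n<m. (cmod (u (Suc n)))\<^sup>2) \<le> (\<Sum>n<Suc m. (cmod (u n))\<^sup>2)"
      unfolding sum.lessThan_Suc_shift[of _ m] by simp
    ultimately show ?thesis using \<mu> s by (intro diff_right_mono add_mono mult_left_mono) linarith+
  qed
  also have "\<dots> = (\<mu> + 1 / \<mu>) * (\<Sum>n<Suc m. (cmod (u n))\<^sup>2)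
      - 2 * (\<Sum>n<m. \<alpha> n * Re (cnj (u n) * u (Suc n)))"
    unfolding s_def by (simp only: left_diff_distrib distrib_right)
  finally have QW: "Q < W" using form unfolding W_def by linarith
  have Q0: "0 \<le> Q"
    unfolding Q_def using s \<rho>2 by (intro add_nonneg_nonneg sum_nonneg) (auto simp: less_imp_le)
  have "0 < W" using Q0 QW by linarith
  then show "0 < (\<Sum>n<Suc m. c n * (cmod (u n))\<^sup>2)" unfolding W_def .
  have "W = (\<Sum>n<Suc m. Re (cnj (u n) * v n))"
    unfolding W_def v_def by (intro sum.cong refl) (simp add: cmod_power2, simp add: power2_eq_square algebra_simps)
  \<comment> \<open>Summation by parts: \<open>v n\<close> is the tail at \<open>n\<close> minus
    \<open>\<rho> n\<close> times the next tail, and the tail at \<open>Suc m\<close> vanishes.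
    Collecting the factors of each tail produces the differences \<open>D n\<close>.\<close>
  also have "\<dots> = (\<Sum>n<Suc m. Re (cnj (u n) * ?T n) - \<rho> n * Re (cnj (u n) * ?T (Suc n)))"
    by (intro sum.cong refl) (simp add: chain_sum_rec[of _ _ \<rho> v], simp add: algebra_simps)
  also have "\<dots> = (\<Sum>n<Suc m. Re (cnj (u n) * ?T n)) - (\<Sum>n<m. \<rho> n * Re (cnj (u n) * ?T (Suc n)))"
    by (simp add: sum_subtractf)
  also have "\<dots> = Re (cnj (u 0) * ?T 0) + (\<Sum>n<m. Re (cnj (D n) * ?T (Suc n)))"
  proof -
    have "Re (cnj (D n) * ?T (Suc n)) = Re (cnj (u (Suc n)) * ?T (Suc n)) - \<rho> n * Re (cnj (u n) * ?T (Suc n))" for n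
      by (simp add: D_def algebra_simps)
    then show ?thesis
      unfolding sum.lessThan_Suc_shift[of _ m] by (simp only: sum_subtractf)
  qed
  finally have "2 * W = 2 * Re (cnj (u 0) * ?T 0) + (\<Sum>n<m. 2 * Re (cnj (D n) * ?T (Suc n)))"
    by (simp only: sum_distrib_left[symmetric]) simp
  \<comment> \<open>The weights in Young's inequality are those of \<open>Q\<close>; their
    reciprocals are the coefficients in \<open>chain_form_squares\<close> divided by
    \<open>s\<close>.\<close>
  also have "\<dots> \<le> (s * (cmod (u 0))\<^sup>2 + (cmod (?T 0))\<^sup>2 / s)
      + (\<Sum>n<m. s / (1 - (\<rho> n)\<^sup>2) * (cmod (D n))\<^sup>2 + (cmod (?T (Suc n)))\<^sup>2 / (s / (1 - (\<rho> n)\<^sup>2)))"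
    using s \<rho>2 by (intro add_mono sum_mono young_cmod) auto
  also have "\<dots> = Q + chain_form (Suc m) \<rho> v / s"
    unfolding Q_def chain_form_squares by (simp add: sum.distrib add_divide_distrib sum_divide_distrib mult_ac)
  finally have "W \<le> chain_form (Suc m) \<rho> v / s" using QW by linarith
  then have "s * W \<le> chain_form (Suc m) \<rho> v" using s by (simp add: pos_le_divide_eq mult.commute)
  then show "s * (\<Sum>n<Suc m. c n * (cmod (u n))\<^sup>2)
      \<le> chain_form (Suc m) (\<lambda>n. \<mu> * \<alpha> n) (\<lambda>n. of_real (c n) * u n)"
    unfolding W_def \<rho>_def v_def .
qed

text \<open>Induction on \<open>k\<close> builds a frame whose trace at \<open>\<mu> k\<close>
  dominates the first k + 1 terms. Raising \<open>\<mu>\<close> to the new value keeps the old terms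
  by \<open>frame_trace_mono\<close>; one further vector, orthogonal to the frame, then contributes
  the new term by Birman-Schwinger. The last trace is at most the sum of \<open>c\<close>.\<close>

lemma lieb_thirring_finite:
  fixes \<phi> :: "nat \<Rightarrow> nat \<Rightarrow> complex" and c \<alpha> \<mu> :: "nat \<Rightarrow> real"
  assumes c: "\<And>n. 0 \<le> c n" and \<alpha>: "\<And>n. \<bar>\<alpha> n\<bar> \<le> 1"
    and \<mu>: "\<And>k. k < N \<Longrightarrow> 0 < \<mu> k" "\<And>k. k < N \<Longrightarrow> \<mu> k < 1"
    and mono: "\<And>j k. j \<le> k \<Longrightarrow> k < N \<Longrightarrow> \<mu> j \<le> \<mu> k"
    and form: "\<And>k z. k < N \<Longrightarrow> (\<exists>j\<le>k. z j \<noteq> 0) \<Longrightarrow>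
      (\<mu> k + 1 / \<mu> k) * (\<Sum>n<Suc m. (cmod (\<Sum>j\<le>k. z j * \<phi> j n))\<^sup>2)
      - 2 * (\<Sum>n<m. \<alpha> n * Re (cnj (\<Sum>j\<le>k. z j * \<phi> j n) * (\<Sum>j\<le>k. z j * \<phi> j (Suc n))))
      < (\<Sum>n<Suc m. c n * (cmod (\<Sum>j\<le>k. z j * \<phi> j n))\<^sup>2)"
  shows "(\<Sum>k<N. 1 / \<mu> k - \<mu> k) \<le> (\<Sum>n<Suc m. c n)"
proof (cases N)
  case 0
  then show ?thesis using c by (simp add: sum_nonneg del: sum.lessThan_Suc)
next
  case (Suc N')
  define d where "d n = sqrt (c n)" for n
  have d2: "(d n)\<^sup>2 = c n" for n using c by (simp add: d_def)
  have dd: "of_real (d n) * of_real (d n) = (of_real (c n) :: complex)" for n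
    using d2[of n] by (simp add: power2_eq_square flip: of_real_mult)
  have "\<exists>x. orthonormal_frame (Suc m) (Suc k) x \<and>
      (\<Sum>j\<le>k. 1 / \<mu> j - \<mu> j) \<le> frame_trace (Suc m) d (\<lambda>n. \<mu> k * \<alpha> n) (Suc k) x" if "k < N" for k
    using that
  proof (induction k rule: less_induct)
    case (less k)
    have "\<exists>x. orthonormal_frame (Suc m) k x \<and>
        (\<Sum>j<k. 1 / \<mu> j - \<mu> j) \<le> frame_trace (Suc m) d (\<lambda>n. \<mu> k * \<alpha> n) k x"
    proof (cases k)
      case 0
      then show ?thesis by (simp add: orthonormal_frame_def frame_trace_def)
    next
      case (Suc k')
      with less.IH[of k'] less.prems obtain y where y: "orthonormal_frame (Suc m) k y"
        "(\<Sum>j<k. 1 / \<mu> j - \<mu> j) \<le> frame_trace (Suc m) d (\<lambda>n. \<mu> k' * \<alpha> n) k y"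
        by (auto simp: lessThan_Suc_atMost)
      have "\<bar>\<mu> k' * \<alpha> l\<bar> \<le> \<bar>\<mu> k * \<alpha> l\<bar>" for l
        using mono[of k' k] \<mu>(1)[of k'] less.prems Suc
        by (auto simp: abs_mult intro!: mult_right_mono)
      from frame_trace_mono[of "Suc m" k y "\<lambda>n. \<mu> k' * \<alpha> n" "\<lambda>n. \<mu> k * \<alpha> n", OF y(1) this, of d]
      show ?thesis using y(2) by (meson order_trans)
    qed
    then obtain x where x: "orthonormal_frame (Suc m) k x"
      "(\<Sum>j<k. 1 / \<mu> j - \<mu> j) \<le> frame_trace (Suc m) d (\<lambda>n. \<mu> k * \<alpha> n) k x" by blast
    \<comment> \<open>There are k + 1 coefficients and k orthogonality conditions: some nontrivial
      combination of the \<open>\<phi> j\<close>, multiplied by the square root of \<open>c\<close>,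
      is orthogonal to the frame.\<close>
    have "\<exists>z. (\<exists>j\<in>{..k}. z j \<noteq> 0) \<and>
        (\<forall>i\<in>{..<k}. (\<Sum>j\<in>{..k}. z j * (\<Sum>n<Suc m. cnj (x i n) * (of_real (d n) * \<phi> j n))) = 0)"
      by (rule homogeneous_system_nontrivial) auto
    then obtain z where z: "\<exists>j\<le>k. z j \<noteq> 0"
      "\<And>i. i < k \<Longrightarrow> (\<Sum>j\<le>k. z j * (\<Sum>n<Suc m. cnj (x i n) * (of_real (d n) * \<phi> j n))) = 0" by auto
    define u where "u n = (\<Sum>j\<le>k. z j * \<phi> j n)" for n
    define w where "w n = of_real (d n) * u n" for n
    define W where "W = (\<Sum>n<Suc m. c n * (cmod (u n))\<^sup>2)"
    have W: "0 < W" "(1 / \<mu> k - \<mu> k) * W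
        \<le> chain_form (Suc m) (\<lambda>n. \<mu> k * \<alpha> n) (\<lambda>n. of_real (c n) * u n)"
      using birman_schwinger_chain[OF \<mu>(1)[OF less.prems] \<mu>(2)[OF less.prems] \<alpha>
          form[OF less.prems z(1), folded u_def]] unfolding W_def by auto
    \<comment> \<open>The squared norm of \<open>w\<close> is \<open>W\<close>, which
      Birman-Schwinger shows to be positive, so \<open>w\<close> can be normalized. Since
      \<open>d n * w n\<close> is \<open>c n * u n\<close>, the form of the new vector is the one
      bounded there, divided by \<open>W\<close>.\<close>
    define t where "t = 1 / sqrt W"
    have t2: "t\<^sup>2 = 1 / W" using W(1) by (simp add: t_def power_divide)
    define x' where "x' i n = (if i = k then of_real t * w n else x i n)" for i n
    have ww: "(\<Sum>n<Suc m. cnj (w n) * w n) = of_real W"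
      unfolding W_def of_real_sum w_def d2[symmetric]
      by (intro sum.cong refl) (simp only: of_real_mult complex_norm_square, simp add: power2_eq_square mult_ac)
    have xw: "(\<Sum>n<Suc m. cnj (x i n) * w n) = 0" if "i < k" for i
    proof -
      have "(\<Sum>n<Suc m. cnj (x i n) * w n)
          = (\<Sum>n<Suc m. \<Sum>j\<le>k. z j * (cnj (x i n) * (of_real (d n) * \<phi> j n)))"
        unfolding w_def u_def sum_distrib_left by (intro sum.cong refl) (simp add: mult_ac)
      also have "\<dots> = (\<Sum>j\<le>k. z j * (\<Sum>n<Suc m. cnj (x i n) * (of_real (d n) * \<phi> j n)))"
        by (subst sum.swap) (simp only: sum_distrib_left)
      also have "\<dots> = 0" using z(2)[OF that] .
      finally show ?thesis .
    qed
    have wx: "(\<Sum>n<Suc m. cnj (w n) * x i n) = 0" if "i < k" for i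
    proof -
      have "(\<Sum>n<Suc m. cnj (w n) * x i n) = cnj (\<Sum>n<Suc m. cnj (x i n) * w n)"
        unfolding cnj_sum by (intro sum.cong refl) (simp add: mult_ac)
      then show ?thesis using xw[OF that] by (simp only: complex_cnj_zero)
    qed
    have "orthonormal_frame (Suc m) (Suc k) x'"
      unfolding orthonormal_frame_def
    proof (intro allI impI)
      fix i j assume ij: "i < Suc k" "j < Suc k"
      consider "i = k" "j = k" | "i = k" "j < k" | "i < k" "j = k" | "i < k" "j < k"
        using ij by linarith
      then show "(\<Sum>n<Suc m. cnj (x' i n) * x' j n) = (if i = j then 1 else 0)"
      proof cases
        case 1
        have "(\<Sum>n<Suc m. cnj (x' i n) * x' j n) = of_real (t\<^sup>2) * (\<Sum>n<Suc m. cnj (w n) * w n)"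
          unfolding sum_distrib_left using 1 by (intro sum.cong refl) (simp add: x'_def power2_eq_square)
        also have "\<dots> = 1" unfolding ww t2 using W(1) by (simp flip: of_real_mult)
        finally show ?thesis using 1 by simp
      next
        case 2
        have "(\<Sum>n<Suc m. cnj (x' i n) * x' j n) = of_real t * (\<Sum>n<Suc m. cnj (w n) * x j n)"
          unfolding sum_distrib_left using 2 by (intro sum.cong refl) (simp add: x'_def)
        then show ?thesis unfolding wx[OF 2(2)] using 2 by simp
      next
        case 3
        have "(\<Sum>n<Suc m. cnj (x' i n) * x' j n) = of_real t * (\<Sum>n<Suc m. cnj (x i n) * w n)"
          unfolding sum_distrib_left using 3 by (intro sum.cong refl) (simp add: x'_def)
        then show ?thesis unfolding xw[OF 3(1)] using 3 by simp
      next
        case 4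
        then show ?thesis using x(1) unfolding orthonormal_frame_def x'_def by auto
      qed
    qed
    moreover have "(\<Sum>j\<le>k. 1 / \<mu> j - \<mu> j) \<le> frame_trace (Suc m) d (\<lambda>n. \<mu> k * \<alpha> n) (Suc k) x'"
    proof -
      have "chain_form (Suc m) (\<lambda>n. \<mu> k * \<alpha> n) (\<lambda>n. of_real (d n) * x' k n)
          = chain_form (Suc m) (\<lambda>n. \<mu> k * \<alpha> n) (\<lambda>n. of_real t * (of_real (c n) * u n))"
        by (intro arg_cong[where f = "chain_form _ _"] ext) (simp add: x'_def w_def mult_ac flip: dd)
      also have "\<dots> = t\<^sup>2 * chain_form (Suc m) (\<lambda>n. \<mu> k * \<alpha> n) (\<lambda>n. of_real (c n) * u n)"
        unfolding chain_form_scale by simp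
      also have "\<dots> \<ge> 1 / \<mu> k - \<mu> k"
        using W unfolding t2 by (simp add: pos_le_divide_eq)
      finally have "1 / \<mu> k - \<mu> k \<le> chain_form (Suc m) (\<lambda>n. \<mu> k * \<alpha> n) (\<lambda>n. of_real (d n) * x' k n)" .
      moreover have "frame_trace (Suc m) d (\<lambda>n. \<mu> k * \<alpha> n) k x' = frame_trace (Suc m) d (\<lambda>n. \<mu> k * \<alpha> n) k x"
        unfolding frame_trace_def x'_def by (intro sum.cong refl) auto
      ultimately show ?thesis
        using x(2) by (simp add: frame_trace_def flip: lessThan_Suc_atMost)
    qed
    ultimately show ?case by blast
  qed
  from this[of N'] Suc obtain x where x: "orthonormal_frame (Suc m) N x"
    "(\<Sum>j<N. 1 / \<mu> j - \<mu> j) \<le> frame_trace (Suc m) d (\<lambda>n. \<mu> N' * \<alpha> n) N x"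
    by (auto simp: lessThan_Suc_atMost)
  have "\<bar>\<mu> N' * \<alpha> l\<bar> \<le> 1" for l
    using \<mu>[of N'] \<alpha>[of l] Suc by (simp add: abs_mult mult_le_one)
  from frame_trace_le[where \<rho> = "\<lambda>n. \<mu> N' * \<alpha> n", OF x(1) this, of d] x(2) show ?thesis by (simp add: d2)
qed

section \<open>Truncation of eigenvectors\<close>

definition l2_inner :: "(int \<Rightarrow> complex) \<Rightarrow> (int \<Rightarrow> complex) \<Rightarrow> complex" where
  "l2_inner u v = (\<Sum>\<^sub>\<infinity>n. cnj (u n) * v n)"

lemma l2_inner_has_sum:
  assumes "u \<in> l2" "v \<in> l2"
  shows "((\<lambda>n. cnj (u n) * v n) has_sum l2_inner u v) UNIV"
proof -
  have "(\<lambda>n. (cmod (u n))\<^sup>2 + (cmod (v n))\<^sup>2) summable_on UNIV"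
    using assms by (intro summable_on_add) (auto simp: l2_def)
  then have "(\<lambda>n. norm (cnj (u n) * v n)) summable_on UNIV"
  proof (rule Infinite_Sum.abs_summable_on_comparison_test')
    fix n
    show "norm (cnj (u n) * v n) \<le> (cmod (u n))\<^sup>2 + (cmod (v n))\<^sup>2"
      using sum_squares_bound[of "cmod (u n)" "cmod (v n)"]
        mult_nonneg_nonneg[of "cmod (u n)" "cmod (v n)"] by (simp add: norm_mult del: mult_nonneg_nonneg)
  qed
  then show ?thesis
    unfolding l2_inner_def by (rule has_sum_infsum[OF abs_summable_summable])
qed

text \<open>The intervals from -R to R eventually contain every finite set of integers. Their 2 R +
  1 sites are numbered from 0 to match the finite chains.\<close>

lemma has_sum_window_limit:
  fixes f :: "int \<Rightarrow> 'a::{comm_monoid_add, topological_space}"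
  assumes "(f has_sum s) UNIV"
  shows "(\<lambda>R. \<Sum>n<Suc (2 * R). f (int n - int R)) \<longlonglongrightarrow> s"
proof -
  have "filterlim (\<lambda>R. {- int R..int R}) (finite_subsets_at_top UNIV) sequentially"
    unfolding filterlim_finite_subsets_at_top
  proof (intro allI impI)
    fix X :: "int set" assume X: "finite X \<and> X \<subseteq> UNIV"
    define K where "K = nat (Max (insert 0 (abs ` X)))"
    have "X \<subseteq> {- int R..int R}" if "K \<le> R" for R
    proof
      fix x assume "x \<in> X"
      then have "\<bar>x\<bar> \<le> Max (insert 0 (abs ` X))" using X by (intro Max_ge) auto
      then show "x \<in> {- int R..int R}" using that unfolding K_def by auto
    qed
    then show "\<forall>\<^sub>F R in sequentially. finite {- int R..int R} \<and> X \<subseteq> {- int R..int R} \<and> {- int R..int R} \<subseteq> UNIV"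
      unfolding eventually_sequentially by auto
  qed
  from filterlim_compose[OF assms[unfolded has_sum_def] this]
  have "(\<lambda>R. sum f {- int R..int R}) \<longlonglongrightarrow> s" .
  moreover have "sum f {- int R..int R} = (\<Sum>n<Suc (2 * R). f (int n - int R))" for R
    by (rule sum.reindex_bij_witness[of _ "\<lambda>n. int n - int R" "\<lambda>k. nat (k + int R)"]) auto
  ultimately show ?thesis by simp
qed

lemma l2_subseq_tendsto_0:
  fixes h :: "nat \<Rightarrow> int"
  assumes "u \<in> l2" "inj h"
  shows "(\<lambda>n. u (h n)) \<longlonglongrightarrow> 0"
proof -
  have "(\<lambda>n. (cmod (u n))\<^sup>2) summable_on range h"
    by (rule summable_on_subset_banach[where A = UNIV]) (use assms(1) in \<open>simp_all add: l2_def\<close>)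
  then have "(\<lambda>n. (cmod (u (h n)))\<^sup>2) summable_on UNIV"
    using assms by (subst (asm) summable_on_reindex) (auto simp: o_def)
  then have "(\<lambda>n. (cmod (u (h n)))\<^sup>2) \<longlonglongrightarrow> 0"
    by (intro summable_LIMSEQ_zero summable_on_imp_summable)
  then have "(\<lambda>n. sqrt ((cmod (u (h n)))\<^sup>2)) \<longlonglongrightarrow> sqrt 0" by (rule tendsto_real_sqrt)
  then show ?thesis by (simp add: tendsto_norm_zero_iff)
qed

text \<open>The sesquilinear form of the compression of the Jacobi operator to the sites l, ..., l +
  m, with m + 1 sites and m inner edges. The couplings through the two cut edges are in
  \<open>window_boundary\<close>.\<close>

definition window_form ::
  "(int \<Rightarrow> real) \<Rightarrow> (int \<Rightarrow> real) \<Rightarrow> int \<Rightarrow> nat \<Rightarrow> (int \<Rightarrow> complex) \<Rightarrow> (int \<Rightarrow> complex) \<Rightarrow> complex" where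
  "window_form a b l m x y = (\<Sum>n<Suc m. of_real (b (int n + l)) * (cnj (x (int n + l)) * y (int n + l)))
     + (\<Sum>n<m. of_real (a (int n + l)) * (cnj (x (int n + l)) * y (int n + l + 1) + cnj (x (int n + l + 1)) * y (int n + l)))"

definition window_boundary ::
  "(int \<Rightarrow> real) \<Rightarrow> int \<Rightarrow> nat \<Rightarrow> (int \<Rightarrow> complex) \<Rightarrow> (int \<Rightarrow> complex) \<Rightarrow> complex" where
  "window_boundary a l m x y = of_real (a (l - 1)) * (cnj (x l) * y (l - 1))
     + of_real (a (int m + l)) * (cnj (x (int m + l)) * y (int m + l + 1))"

lemma window_green:
  "(\<Sum>n<Suc m. cnj (x (int n + l)) * jacobi a b y (int n + l))
     = window_form a b l m x y + window_boundary a l m x y"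
proof (induction m)
  case 0
  show ?case
    by (simp add: window_form_def window_boundary_def jacobi_def) (simp only: distrib_left mult_ac add_ac)
next
  case (Suc m)
  define k where "k = int m + l"
  have k: "int (Suc m) + l = k + 1" by (simp add: k_def)
  have form: "window_form a b l (Suc m) x y = window_form a b l m x y
      + of_real (b (k + 1)) * (cnj (x (k + 1)) * y (k + 1))
      + of_real (a k) * (cnj (x k) * y (k + 1) + cnj (x (k + 1)) * y k)"
    unfolding window_form_def sum.lessThan_Suc[of _ "Suc m"] sum.lessThan_Suc[of _ m] k k_def[symmetric]
    by (simp only: add_ac)
  have jac: "cnj (x (k + 1)) * jacobi a b y (k + 1)
      = of_real (b (k + 1)) * (cnj (x (k + 1)) * y (k + 1)) + of_real (a k) * (cnj (x (k + 1)) * y k)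
        + of_real (a (k + 1)) * (cnj (x (k + 1)) * y (k + 1 + 1))"
    unfolding jacobi_def add_diff_cancel_right' by (simp only: distrib_left mult_ac add_ac)
  \<comment> \<open>The old right boundary term \<open>\<alpha> * q\<close> and the term
    \<open>\<alpha> * t'\<close> of the new row together form the new inner edge; \<open>r\<close>
    is the new right boundary term.\<close>
  have "w + (p + \<alpha> * q) + (t + \<alpha> * t' + r) = w + t + \<alpha> * (q + t') + (p + r)"
    for w p q r t t' \<alpha> :: complex
    by (simp only: distrib_left add_ac)
  then show ?case
    unfolding sum.lessThan_Suc[of _ "Suc m"] Suc.IH k form jac window_boundary_def k_def[symmetric]
    .
qed

lemma window_form_cnj: "cnj (window_form a b l m x y) = window_form a b l m y x"
  unfolding window_form_def complex_cnj_add cnj_sum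
  by (intro arg_cong2[where f = "(+)"] sum.cong refl)
    (simp_all only: complex_cnj_mult complex_cnj_add complex_cnj_cnj complex_cnj_complex_of_real mult.commute add.commute)

lemma window_boundary_tendsto_0:
  assumes "\<And>n. \<bar>a n\<bar> \<le> K" "x \<in> l2" "y \<in> l2"
  shows "(\<lambda>R. window_boundary a (- int R) (2 * R) x y) \<longlonglongrightarrow> 0"
proof -
  have bdd: "Bfun (\<lambda>R. complex_of_real (a (h R))) sequentially" for h :: "nat \<Rightarrow> int"
    by (rule BfunI[of _ K]) (use assms(1) in auto)
  have t: "(\<lambda>R. complex_of_real (a (g R)) * (cnj (x (h R)) * y (k R))) \<longlonglongrightarrow> 0"
    if "inj h" "inj k" for g h k :: "nat \<Rightarrow> int"
  proof -
    have "(\<lambda>R. cnj (x (h R)) * y (k R)) \<longlonglongrightarrow> cnj 0 * 0"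
      by (intro tendsto_intros l2_subseq_tendsto_0 assms that)
    then have "Zfun (\<lambda>R. complex_of_real (a (g R)) * (cnj (x (h R)) * y (k R))) sequentially"
      using bounded_bilinear.Bfun_prod_Zfun[OF bounded_bilinear_mult bdd] by (simp add: tendsto_Zfun_iff)
    then show ?thesis by (simp add: tendsto_Zfun_iff)
  qed
  have "inj (\<lambda>R. - int R)" "inj (\<lambda>R. - int R - 1)" "inj (\<lambda>R. int (2 * R) + - int R)"
    "inj (\<lambda>R. int (2 * R) + - int R + 1)" by (auto simp: inj_def)
  from tendsto_add[OF t[OF this(1,2)] t[OF this(3,4)]]
  show ?thesis unfolding window_boundary_def by simp
qed

lemma l2_inner_limit:
  assumes "x \<in> l2" "y \<in> l2"
  shows "(\<lambda>R. \<Sum>n<Suc (2 * R). cnj (x (int n + - int R)) * y (int n + - int R)) \<longlonglongrightarrow> l2_inner x y"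
  using has_sum_window_limit[OF l2_inner_has_sum[OF assms]] by (simp only: diff_conv_add_uminus)

lemma window_form_eigenvector:
  assumes "jacobi a b y = seq_scale (of_real E) y"
  shows "window_form a b l m x y
    = of_real E * (\<Sum>n<Suc m. cnj (x (int n + l)) * y (int n + l)) - window_boundary a l m x y"
proof -
  have "(\<Sum>n<Suc m. cnj (x (int n + l)) * jacobi a b y (int n + l))
      = of_real E * (\<Sum>n<Suc m. cnj (x (int n + l)) * y (int n + l))"
    unfolding assms sum_distrib_left by (intro sum.cong refl) (simp only: seq_scale_def mult_ac)
  then show ?thesis unfolding window_green eq_diff_eq .
qed

text \<open>Symmetry of the operator, tested on windows: the window form of \<open>x\<close> and
  \<open>y\<close> can be evaluated with either eigenvector, and the two results differ by (F - E)
  times the truncated inner product and by boundary terms that vanish in the limit.\<close>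

lemma eigenspaces_orthogonal:
  assumes a: "\<And>n. \<bar>a n\<bar> \<le> K"
    and x: "x \<in> eigenspace (jacobi a b) E" and y: "y \<in> eigenspace (jacobi a b) F" and "E \<noteq> F"
  shows "l2_inner x y = 0"
proof -
  have x': "x \<in> l2" "jacobi a b x = seq_scale (of_real E) x"
    and y': "y \<in> l2" "jacobi a b y = seq_scale (of_real F) y"
    using x y by (simp_all add: eigenspace_def)
  define B where "B x y R = (\<Sum>n<Suc (2 * R). cnj (x (int n + - int R)) * y (int n + - int R))"
    for x y :: "int \<Rightarrow> complex" and R
  define b' where "b' x y R = window_boundary a (- int R) (2 * R) x y" for x y R
  have "of_real F * B x y R - b' x y R = cnj (of_real E * B y x R - b' y x R)" for R
    using window_form_cnj[of a b "- int R" "2 * R" y x]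
    unfolding B_def b'_def window_form_eigenvector[OF y'(2)] window_form_eigenvector[OF x'(2)]
    by (rule sym)
  moreover have "cnj (B y x R) = B x y R" for R
    unfolding B_def cnj_sum by (rule sum.cong) simp_all
  ultimately have eq: "of_real (F - E) * B x y R = b' x y R - cnj (b' y x R)" for R
    by (simp add: algebra_simps)
  have "(\<lambda>R. of_real (F - E) * B x y R) \<longlonglongrightarrow> of_real (F - E) * l2_inner x y"
    unfolding B_def by (intro tendsto_mult tendsto_const l2_inner_limit x'(1) y'(1))
  moreover have "(\<lambda>R. b' x y R - cnj (b' y x R)) \<longlonglongrightarrow> 0 - cnj 0"
    unfolding b'_def by (intro tendsto_diff tendsto_cnj window_boundary_tendsto_0[OF a] x'(1) y'(1))
  ultimately have "of_real (F - E) * l2_inner x y = 0 - cnj 0"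
    unfolding eq by (rule LIMSEQ_unique)
  then show ?thesis using assms(4) by simp
qed

text \<open>The diagonal part is at least \<delta> times the squared norm of \<open>z\<close>. By |z
  i| |z j| \<le> (|z i|^2 + |z j|^2) / 2 the perturbation is at most (k + 1) \<epsilon> times the
  same norm.\<close>

lemma near_diagonal_form_pos:
  fixes G :: "nat \<Rightarrow> nat \<Rightarrow> complex" and D :: "nat \<Rightarrow> real"
  assumes G: "\<And>i j. i \<le> k \<Longrightarrow> j \<le> k \<Longrightarrow> cmod (G i j - (if i = j then of_real (D j) else 0)) \<le> \<epsilon>"
    and D: "\<And>j. j \<le> k \<Longrightarrow> \<delta> \<le> D j" and \<epsilon>: "real (Suc k) * \<epsilon> < \<delta>" and z: "\<exists>j\<le>k. z j \<noteq> 0"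
  shows "0 < Re (\<Sum>i\<le>k. \<Sum>j\<le>k. cnj (z i) * z j * G i j)"
proof -
  define H where "H i j = G i j - (if i = j then of_real (D j) else 0)" for i j
  define Z where "Z = (\<Sum>j\<le>k. (cmod (z j))\<^sup>2)"
  have Z: "0 < Z"
  proof -
    obtain j where "j \<le> k" "z j \<noteq> 0" using z by blast
    then have "0 < (cmod (z j))\<^sup>2" "j \<in> {..k}" by auto
    then show ?thesis unfolding Z_def by (intro sum_pos2[where i = j]) auto
  qed
  have "(\<Sum>i\<le>k. \<Sum>j\<le>k. cnj (z i) * z j * G i j)
      = (\<Sum>i\<le>k. \<Sum>j\<le>k. cnj (z i) * z j * (if i = j then of_real (D j) else 0))
       + (\<Sum>i\<le>k. \<Sum>j\<le>k. cnj (z i) * z j * H i j)"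
    unfolding H_def sum.distrib[symmetric] by (intro sum.cong refl) (simp add: algebra_simps)
  also have "(\<Sum>i\<le>k. \<Sum>j\<le>k. cnj (z i) * z j * (if i = j then of_real (D j) else 0))
      = (\<Sum>i\<le>k. cnj (z i) * z i * of_real (D i))"
    by (intro sum.cong refl) (simp add: if_distrib cong: if_cong)
  also have "\<dots> = of_real (\<Sum>j\<le>k. D j * (cmod (z j))\<^sup>2)"
    unfolding of_real_sum by (intro sum.cong refl) (simp only: of_real_mult complex_norm_square mult_ac)
  finally have eq: "Re (\<Sum>i\<le>k. \<Sum>j\<le>k. cnj (z i) * z j * G i j)
      = (\<Sum>j\<le>k. D j * (cmod (z j))\<^sup>2) + Re (\<Sum>i\<le>k. \<Sum>j\<le>k. cnj (z i) * z j * H i j)" by simp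
  have "\<delta> * Z \<le> (\<Sum>j\<le>k. D j * (cmod (z j))\<^sup>2)"
    unfolding Z_def sum_distrib_left by (intro sum_mono mult_right_mono D) auto
  moreover have "cmod (\<Sum>i\<le>k. \<Sum>j\<le>k. cnj (z i) * z j * H i j) \<le> real (Suc k) * \<epsilon> * Z"
  proof -
    have "cmod (\<Sum>i\<le>k. \<Sum>j\<le>k. cnj (z i) * z j * H i j)
        \<le> (\<Sum>i\<le>k. \<Sum>j\<le>k. ((cmod (z i))\<^sup>2 + (cmod (z j))\<^sup>2) / 2 * \<epsilon>)"
    proof (intro sum_norm_le)
      fix i j assume ij: "i \<in> {..k}" "j \<in> {..k}"
      have "cmod (cnj (z i) * z j) \<le> ((cmod (z i))\<^sup>2 + (cmod (z j))\<^sup>2) / 2"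
        using sum_squares_bound[of "cmod (z i)" "cmod (z j)"] by (simp add: norm_mult)
      moreover have "cmod (H i j) \<le> \<epsilon>" unfolding H_def using G ij by auto
      ultimately show "cmod (cnj (z i) * z j * H i j) \<le> ((cmod (z i))\<^sup>2 + (cmod (z j))\<^sup>2) / 2 * \<epsilon>"
        unfolding norm_mult[of "cnj (z i) * z j"] by (intro mult_mono) auto
    qed
    also have "\<dots> = real (Suc k) * \<epsilon> * Z"
      unfolding Z_def
      by (simp add: sum_distrib_right[symmetric] sum_divide_distrib[symmetric] sum.distrib sum_distrib_left[symmetric] field_simps)
    finally show ?thesis .
  qed
  moreover have "real (Suc k) * \<epsilon> * Z < \<delta> * Z" using \<epsilon> Z by (rule mult_strict_right_mono)
  ultimately show ?thesis
    unfolding eq using abs_Re_le_cmod[of "\<Sum>i\<le>k. \<Sum>j\<le>k. cnj (z i) * z j * H i j"] by linarith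
qed

lemma jacobi_sum:
  "jacobi a b (\<lambda>n. \<Sum>j\<in>S. z j * \<psi> j n) = (\<lambda>n. \<Sum>j\<in>S. z j * jacobi a b (\<psi> j) n)"
  by (simp add: jacobi_def sum_distrib_left sum.distrib[symmetric] algebra_simps)

lemma sesquilinear_sum:
  fixes z p q :: "'i \<Rightarrow> complex"
  shows "cnj (\<Sum>i\<in>S. z i * p i) * (\<Sum>j\<in>S. z j * q j) = (\<Sum>i\<in>S. \<Sum>j\<in>S. cnj (z i) * z j * (cnj (p i) * q j))"
  unfolding cnj_sum sum_product by (intro sum.cong refl) (simp only: complex_cnj_mult mult_ac)

text \<open>With respect to the \<open>\<psi> j\<close>, the window form minus E k - \<delta> has
  the matrix \<open>G\<close>. By Green's identity and orthonormality it converges to the diagonal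
  matrix with entries E j - E k + \<delta>, which are at least \<delta> by the ordering. There are
  finitely many entries, so one \<open>R\<close> serves all \<open>k\<close> and
  \<open>z\<close>.\<close>

lemma eventually_truncated_form_pos:
  fixes \<psi> :: "nat \<Rightarrow> int \<Rightarrow> complex"
  assumes a: "\<And>n. \<bar>a n\<bar> \<le> K"
    and l2: "\<And>j. j < N \<Longrightarrow> \<psi> j \<in> l2"
    and ev: "\<And>j. j < N \<Longrightarrow> jacobi a b (\<psi> j) = seq_scale (of_real (E j)) (\<psi> j)"
    and orth: "\<And>i j. i < N \<Longrightarrow> j < N \<Longrightarrow> l2_inner (\<psi> i) (\<psi> j) = (if i = j then 1 else 0)"
    and mono: "\<And>j k. j \<le> k \<Longrightarrow> k < N \<Longrightarrow> E k \<le> E j" and \<delta>: "0 < \<delta>"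
  shows "\<forall>\<^sub>F R in sequentially. \<forall>k<N. \<forall>z. (\<exists>j\<le>k. z j \<noteq> 0) \<longrightarrow>
    (let u = (\<lambda>n. \<Sum>j\<le>k. z j * \<psi> j n) in
      (E k - \<delta>) * (\<Sum>n<Suc (2 * R). (cmod (u (int n + - int R)))\<^sup>2)
        < Re (window_form a b (- int R) (2 * R) u u))"
proof -
  define B where "B i j R = (\<Sum>n<Suc (2 * R). cnj (\<psi> i (int n + - int R)) * \<psi> j (int n + - int R))" for i j R
  define b' where "b' i j R = window_boundary a (- int R) (2 * R) (\<psi> i) (\<psi> j)" for i j R
  define G where "G k R i j = of_real (E j - E k + \<delta>) * B i j R - b' i j R" for k R i j
  define \<epsilon> where "\<epsilon> = \<delta> / (2 * real (Suc N))"
  have \<epsilon>: "0 < \<epsilon>" using \<delta> by (simp add: \<epsilon>_def)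
  have "(\<lambda>R. G k R i j) \<longlonglongrightarrow> of_real (E j - E k + \<delta>) * l2_inner (\<psi> i) (\<psi> j) - 0"
    if "i < N" "j < N" for i j k
    unfolding G_def B_def b'_def using that
    by (intro tendsto_diff tendsto_mult tendsto_const l2_inner_limit window_boundary_tendsto_0[OF a] l2)
  then have lim: "\<forall>\<^sub>F R in sequentially. dist (G k R i j) (of_real (E j - E k + \<delta>) * l2_inner (\<psi> i) (\<psi> j) - 0) < \<epsilon>"
    if "i < N" "j < N" for i j k
    using that \<epsilon> by (blast dest: tendstoD)
  have "\<forall>\<^sub>F R in sequentially. cmod (G k R i j - (if i = j then of_real (E j - E k + \<delta>) else 0)) \<le> \<epsilon>"
    if "i < N" "j < N" for i j k
    by (rule eventually_mono[OF lim[OF that, of k]]) (use that in \<open>auto simp: orth dist_norm split: if_splits\<close>)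
  then have "\<forall>\<^sub>F R in sequentially. \<forall>k\<in>{..<N}. \<forall>i\<in>{..<N}. \<forall>j\<in>{..<N}.
      cmod (G k R i j - (if i = j then of_real (E j - E k + \<delta>) else 0)) \<le> \<epsilon>"
    by (intro eventually_ball_finite ballI) auto
  then show ?thesis
  proof (rule eventually_mono, intro allI impI)
    fix R k and z :: "nat \<Rightarrow> complex"
    assume G: "\<forall>k\<in>{..<N}. \<forall>i\<in>{..<N}. \<forall>j\<in>{..<N}.
      cmod (G k R i j - (if i = j then of_real (E j - E k + \<delta>) else 0)) \<le> \<epsilon>"
      and k: "k < N" and z: "\<exists>j\<le>k. z j \<noteq> 0"
    define u where "u n = (\<Sum>j\<le>k. z j * \<psi> j n)" for n
    let ?g = "\<lambda>n. int n + - int R"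
    have Ju: "jacobi a b u n = (\<Sum>j\<le>k. z j * (of_real (E j) * \<psi> j n))" for n
      unfolding u_def[abs_def] jacobi_sum using k ev by (intro sum.cong refl) (simp add: seq_scale_def)
    have lin: "(\<Sum>n<Suc (2 * R). cnj (u (?g n)) * (\<Sum>j\<le>k. z j * (c j * \<psi> j (?g n))))
        = (\<Sum>i\<le>k. \<Sum>j\<le>k. cnj (z i) * z j * (c j * B i j R))" for c :: "nat \<Rightarrow> complex"
    proof -
      have "(\<Sum>n<Suc (2 * R). cnj (u (?g n)) * (\<Sum>j\<le>k. z j * (c j * \<psi> j (?g n))))
          = (\<Sum>n<Suc (2 * R). \<Sum>i\<le>k. \<Sum>j\<le>k. cnj (z i) * z j * (c j * (cnj (\<psi> i (?g n)) * \<psi> j (?g n))))"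
        unfolding u_def sesquilinear_sum by (intro sum.cong refl) (simp only: mult_ac)
      also have "\<dots> = (\<Sum>i\<le>k. \<Sum>j\<le>k. \<Sum>n<Suc (2 * R). cnj (z i) * z j * (c j * (cnj (\<psi> i (?g n)) * \<psi> j (?g n))))"
        by (rule trans[OF sum.swap sum.cong[OF refl sum.swap]])
      finally show ?thesis unfolding B_def sum_distrib_left .
    qed
    have bd: "window_boundary a (- int R) (2 * R) u u = (\<Sum>i\<le>k. \<Sum>j\<le>k. cnj (z i) * z j * b' i j R)"
      unfolding window_boundary_def b'_def u_def sesquilinear_sum
      unfolding sum_distrib_left sum.distrib[symmetric]
      by (intro sum.cong refl) (simp only: distrib_left mult_ac)
    have uu: "of_real (\<Sum>n<Suc (2 * R). (cmod (u (?g n)))\<^sup>2) = (\<Sum>i\<le>k. \<Sum>j\<le>k. cnj (z i) * z j * B i j R)"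
    proof -
      have "of_real (\<Sum>n<Suc (2 * R). (cmod (u (?g n)))\<^sup>2) = (\<Sum>n<Suc (2 * R). cnj (u (?g n)) * u (?g n))"
        unfolding of_real_sum by (intro sum.cong refl) (simp only: complex_norm_square mult_ac)
      also have "\<dots> = (\<Sum>i\<le>k. \<Sum>j\<le>k. cnj (z i) * z j * B i j R)"
        using lin[of "\<lambda>_. 1"] by (simp add: u_def)
      finally show ?thesis .
    qed
    have "window_form a b (- int R) (2 * R) u u - of_real ((E k - \<delta>) * (\<Sum>n<Suc (2 * R). (cmod (u (?g n)))\<^sup>2))
        = (\<Sum>i\<le>k. \<Sum>j\<le>k. cnj (z i) * z j * G k R i j)"
    proof -
      have "window_form a b (- int R) (2 * R) u u
          = (\<Sum>i\<le>k. \<Sum>j\<le>k. cnj (z i) * z j * (of_real (E j) * B i j R))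
            - (\<Sum>i\<le>k. \<Sum>j\<le>k. cnj (z i) * z j * b' i j R)"
        using window_green[of u "- int R" a b u "2 * R"] unfolding Ju lin bd by (simp add: algebra_simps)
      moreover have "complex_of_real ((E k - \<delta>) * (\<Sum>n<Suc (2 * R). (cmod (u (?g n)))\<^sup>2))
          = (\<Sum>i\<le>k. \<Sum>j\<le>k. of_real (E k - \<delta>) * (cnj (z i) * z j * B i j R))"
        unfolding of_real_mult uu unfolding sum_distrib_left ..
      ultimately show ?thesis
        unfolding G_def sum_subtractf[symmetric]
        by (simp only: sum_subtractf[symmetric]) (intro sum.cong refl, simp add: algebra_simps)
    qed
    moreover have "0 < Re (\<Sum>i\<le>k. \<Sum>j\<le>k. cnj (z i) * z j * G k R i j)"
    proof (rule near_diagonal_form_pos)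
      show "cmod (G k R i j - (if i = j then of_real (E j - E k + \<delta>) else 0)) \<le> \<epsilon>" if "i \<le> k" "j \<le> k" for i j
        using G that k by auto
      show "\<delta> \<le> E j - E k + \<delta>" if "j \<le> k" for j using mono[OF that k] by simp
      have "real (Suc k) * \<epsilon> \<le> real (Suc N) * \<epsilon>" using k \<epsilon> by (intro mult_right_mono) auto
      also have "\<dots> = \<delta> / 2" by (simp add: \<epsilon>_def del: of_nat_Suc)
      finally show "real (Suc k) * \<epsilon> < \<delta>" using \<delta> by simp
    qed (rule z)
    ultimately have "0 < Re (window_form a b (- int R) (2 * R) u u
        - of_real ((E k - \<delta>) * (\<Sum>n<Suc (2 * R). (cmod (u (?g n)))\<^sup>2)))" by simp
    then show "let u = (\<lambda>n. \<Sum>j\<le>k. z j * \<psi> j n) in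
      (E k - \<delta>) * (\<Sum>n<Suc (2 * R). (cmod (u (int n + - int R)))\<^sup>2)
        < Re (window_form a b (- int R) (2 * R) u u)"
      unfolding Let_def u_def[abs_def, symmetric] by (simp only: minus_complex.sel Re_complex_of_real diff_gt_0_iff_gt)
  qed
qed

section \<open>Families of eigenvectors\<close>

text \<open>Split a = min a 1 + max (a - 1) 0. By 2 Re(cnj x * y) \<le> |x|^2 + |y|^2 the excess of
  an edge over 1 is charged to both of its end sites, so each excess occurs twice in the
  diagonal.\<close>

lemma window_form_le:
  "Re (window_form a b l m u u)
    \<le> 2 * (\<Sum>n<m. min (a (int n + l)) 1 * Re (cnj (u (int n + l)) * u (int (Suc n) + l)))
      + (\<Sum>n<Suc m. (max (b (int n + l)) 0 + max (a (int n + l) - 1) 0 + max (a (int n + l - 1) - 1) 0)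
          * (cmod (u (int n + l)))\<^sup>2)"
proof -
  define w where "w n = u (int n + l)" for n
  define r where "r n = Re (cnj (w n) * w (Suc n))" for n
  define N where "N n = (cmod (w n))\<^sup>2" for n
  define p where "p k = max (a k - 1) 0" for k
  have N: "0 \<le> N n" for n by (simp add: N_def)
  have p: "0 \<le> p k" for k by (simp add: p_def)
  have S: "int n + l + 1 = int (Suc n) + l" "int (Suc n) + l - 1 = int n + l" for n by simp_all
  have edge: "a k * (2 * r n) \<le> 2 * (min (a k) 1 * r n) + (p k * N n + p k * N (Suc n))" for k n
  proof -
    have "\<bar>r n\<bar> \<le> cmod (w n) * cmod (w (Suc n))"
      unfolding r_def using abs_Re_le_cmod[of "cnj (w n) * w (Suc n)"] by (simp add: norm_mult)
    then have "2 * r n \<le> N n + N (Suc n)"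
      unfolding N_def using sum_squares_bound[of "cmod (w n)" "cmod (w (Suc n))"] by linarith
    then have "p k * (2 * r n) \<le> p k * (N n + N (Suc n))" using p by (rule mult_left_mono)
    moreover have "a k = min (a k) 1 + p k" by (auto simp: p_def)
    then have "a k * (2 * r n) = 2 * (min (a k) 1 * r n) + p k * (2 * r n)"
      by (metis distrib_right mult.left_commute)
    ultimately show ?thesis by (simp add: distrib_left)
  qed
  have diag: "Re (of_real t * (cnj z * z)) = t * (cmod z)\<^sup>2" for t z
    by (simp add: cmod_power2, simp add: power2_eq_square algebra_simps)
  have off: "Re (of_real t * (cnj x * y + cnj y * x)) = t * (2 * Re (cnj x * y))" for t x y
    by (simp add: algebra_simps)
  have "Re (window_form a b l m u u) = (\<Sum>n<Suc m. b (int n + l) * N n) + (\<Sum>n<m. a (int n + l) * (2 * r n))"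
    unfolding window_form_def plus_complex.sel Re_sum diag off S N_def w_def r_def ..
  also have "\<dots> \<le> (\<Sum>n<Suc m. max (b (int n + l)) 0 * N n)
      + (\<Sum>n<m. 2 * (min (a (int n + l)) 1 * r n) + (p (int n + l) * N n + p (int n + l) * N (Suc n)))"
    by (intro add_mono sum_mono edge mult_right_mono N) auto
  also have "\<dots> = (\<Sum>n<Suc m. max (b (int n + l)) 0 * N n) + 2 * (\<Sum>n<m. min (a (int n + l)) 1 * r n)
      + (\<Sum>n<m. p (int n + l) * N n) + (\<Sum>n<m. p (int n + l) * N (Suc n))"
    by (simp only: sum.distrib sum_distrib_left add_ac)
  \<comment> \<open>The excesses of the two cut edges are added, so that all sites of the window get
    the same formula.\<close>
  also have "\<dots> \<le> (\<Sum>n<Suc m. max (b (int n + l)) 0 * N n) + 2 * (\<Sum>n<m. min (a (int n + l)) 1 * r n)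
      + (\<Sum>n<Suc m. p (int n + l) * N n) + (\<Sum>n<Suc m. p (int n + l - 1) * N n)"
  proof (intro add_mono order_refl)
    show "(\<Sum>n<m. p (int n + l) * N n) \<le> (\<Sum>n<Suc m. p (int n + l) * N n)" using p N by simp
    show "(\<Sum>n<m. p (int n + l) * N (Suc n)) \<le> (\<Sum>n<Suc m. p (int n + l - 1) * N n)"
      unfolding sum.lessThan_Suc_shift[of _ m] S using p N by simp
  qed
  also have "\<dots> = 2 * (\<Sum>n<m. min (a (int n + l)) 1 * r n)
      + (\<Sum>n<Suc m. (max (b (int n + l)) 0 + p (int n + l) + p (int n + l - 1)) * N n)"
    by (simp only: distrib_right sum.distrib add_ac)
  finally show ?thesis unfolding p_def N_def r_def w_def .
qed

lemma sum_window_le_infsum: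
  fixes f :: "int \<Rightarrow> real"
  assumes "f summable_on UNIV" "\<And>n. 0 \<le> f n"
  shows "(\<Sum>n<M. f (int n + l)) \<le> (\<Sum>\<^sub>\<infinity>n. f n)"
proof -
  have "(\<Sum>n<M. f (int n + l)) = sum f ((\<lambda>n. int n + l) ` {..<M})"
    by (subst sum.reindex) (auto simp: inj_on_def)
  also have "\<dots> \<le> (\<Sum>\<^sub>\<infinity>n. f n)"
    using assms by (intro finite_sum_le_infsum) auto
  finally show ?thesis .
qed

text \<open>The smaller root of \<mu> + 1/\<mu> = e, rationalized by (e - s) (e + s) = 4. In this
  form it is visibly decreasing in \<open>e\<close>.\<close>

lemma joukowski_inverse:
  fixes e :: real
  assumes "2 < e"
  defines "\<mu> \<equiv> 2 / (e + sqrt (e\<^sup>2 - 4))"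
  shows "0 < \<mu>" "\<mu> < 1" "\<mu> + 1 / \<mu> = e" "1 / \<mu> - \<mu> = sqrt (e\<^sup>2 - 4)"
proof -
  define s where "s = sqrt (e\<^sup>2 - 4)"
  have "(2::real)\<^sup>2 < e\<^sup>2" using assms(1) by (intro power_strict_mono) auto
  then have s: "0 < s" "s\<^sup>2 = e\<^sup>2 - 4" by (simp_all add: s_def)
  have inv: "1 / \<mu> = (e + s) / 2" by (simp add: \<mu>_def s_def)
  have "(e - s) * (e + s) = 4" using s(2) by (simp add: algebra_simps power2_eq_square)
  then have \<mu>: "\<mu> = (e - s) / 2"
    using assms(1) s(1) unfolding \<mu>_def s_def[symmetric] by (simp add: divide_eq_eq)
  show "0 < \<mu>" "\<mu> < 1" using assms(1) s(1) unfolding \<mu>_def s_def[symmetric] by simp_all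
  show "\<mu> + 1 / \<mu> = e" "1 / \<mu> - \<mu> = sqrt (e\<^sup>2 - 4)"
    unfolding inv unfolding \<mu> s_def[symmetric] by (simp_all add: field_simps)
qed

lemma joukowski_inverse_antimono:
  fixes e e' :: real
  assumes "2 < e" "e \<le> e'"
  shows "2 / (e' + sqrt (e'\<^sup>2 - 4)) \<le> 2 / (e + sqrt (e\<^sup>2 - 4))"
proof -
  have "(2::real)\<^sup>2 < e\<^sup>2" using assms by (intro power_strict_mono) auto
  moreover have "e\<^sup>2 \<le> e'\<^sup>2" using assms by (intro power_mono) auto
  ultimately have "0 \<le> sqrt (e\<^sup>2 - 4)" "sqrt (e\<^sup>2 - 4) \<le> sqrt (e'\<^sup>2 - 4)" by simp_all
  then have "0 < e + sqrt (e\<^sup>2 - 4)" "e + sqrt (e\<^sup>2 - 4) \<le> e' + sqrt (e'\<^sup>2 - 4)"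
    using assms by linarith+
  then show ?thesis by (intro divide_left_mono mult_pos_pos) linarith+
qed

text \<open>For small \<delta> > 0 the finite inequality applies on a large window with E k -
  \<delta> in place of \<open>E k\<close>. The bound depends neither on the window nor on \<delta>,
  and \<delta> tends to 0 at the end.\<close>

lemma lieb_thirring_ordered:
  fixes \<psi> :: "nat \<Rightarrow> int \<Rightarrow> complex"
  assumes a: "\<And>n. a n \<ge> -1"
    and sb: "(\<lambda>n. max (b n) 0) summable_on UNIV"
    and sa: "(\<lambda>n. max (a n - 1) 0) summable_on UNIV"
    and l2: "\<And>j. j < N \<Longrightarrow> \<psi> j \<in> l2"
    and ev: "\<And>j. j < N \<Longrightarrow> jacobi a b (\<psi> j) = seq_scale (of_real (E j)) (\<psi> j)"
    and orth: "\<And>i j. i < N \<Longrightarrow> j < N \<Longrightarrow> l2_inner (\<psi> i) (\<psi> j) = (if i = j then 1 else 0)"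
    and mono: "\<And>j k. j \<le> k \<Longrightarrow> k < N \<Longrightarrow> E k \<le> E j" and E: "\<And>k. k < N \<Longrightarrow> 2 < E k"
  shows "(\<Sum>k<N. sqrt ((E k)\<^sup>2 - 4)) \<le> (\<Sum>\<^sub>\<infinity>n. max (b n) 0) + 2 * (\<Sum>\<^sub>\<infinity>n. max (a n - 1) 0)"
    (is "_ \<le> ?D")
proof -
  define A where "A = (\<Sum>\<^sub>\<infinity>n. max (a n - 1) 0)"
  have A: "max (a n - 1) 0 \<le> A" for n
    using finite_sum_le_infsum[OF sa, of "{n}"] by (simp add: A_def)
  have bdd: "\<bar>a n\<bar> \<le> 1 + A" for n using a[of n] A[of n] by linarith
  have bound: "(\<Sum>k<N. sqrt ((E k - \<delta>)\<^sup>2 - 4)) \<le> ?D"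
    if \<delta>: "0 < \<delta>" and E\<delta>: "\<forall>k\<in>{..<N}. \<delta> < E k - 2" for \<delta>
  proof -
    have e: "2 < E k - \<delta>" if "k < N" for k using E\<delta> that by force
    define \<mu> where "\<mu> k = 2 / (E k - \<delta> + sqrt ((E k - \<delta>)\<^sup>2 - 4))" for k
    note jouk = joukowski_inverse[OF e, folded \<mu>_def]
    from eventually_truncated_form_pos[OF bdd l2 ev orth mono \<delta>]
    obtain R where R: "\<And>k z. k < N \<Longrightarrow> (\<exists>j\<le>k. z j \<noteq> 0) \<Longrightarrow>
      (let u = (\<lambda>n. \<Sum>j\<le>k. z j * \<psi> j n) in
        (E k - \<delta>) * (\<Sum>n<Suc (2 * R). (cmod (u (int n + - int R)))\<^sup>2)
          < Re (window_form a b (- int R) (2 * R) u u))"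
      unfolding eventually_sequentially by blast
    define l where "l = - int R"
    define c where "c n = max (b (int n + l)) 0 + max (a (int n + l) - 1) 0 + max (a (int n + l - 1) - 1) 0" for n
    define \<alpha> where "\<alpha> n = min (a (int n + l)) 1" for n
    have "(\<Sum>k<N. 1 / \<mu> k - \<mu> k) \<le> (\<Sum>n<Suc (2 * R). c n)"
    proof (rule lieb_thirring_finite[where \<alpha> = \<alpha> and \<phi> = "\<lambda>j n. \<psi> j (int n + l)"])
      show "0 \<le> c n" for n by (simp add: c_def)
      \<comment> \<open>The hypothesis a n \<ge> -1 gives the lower half of this bound.\<close>
      show "\<bar>\<alpha> n\<bar> \<le> 1" for n using a[of "int n + l"] by (auto simp: \<alpha>_def abs_le_iff)
      show "0 < \<mu> k" "\<mu> k < 1" if "k < N" for k using jouk(1,2)[OF that] .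
      show "\<mu> j \<le> \<mu> k" if "j \<le> k" "k < N" for j k
        unfolding \<mu>_def using mono[OF that] e[OF that(2)] by (intro joukowski_inverse_antimono) auto
      fix k and z :: "nat \<Rightarrow> complex" assume k: "k < N" and z: "\<exists>j\<le>k. z j \<noteq> 0"
      define u where "u n = (\<Sum>j\<le>k. z j * \<psi> j n)" for n
      have "(E k - \<delta>) * (\<Sum>n<Suc (2 * R). (cmod (u (int n + l)))\<^sup>2) < Re (window_form a b l (2 * R) u u)"
        using R[OF k z] unfolding Let_def u_def[abs_def, symmetric] l_def[symmetric] .
      also have "\<dots> \<le> 2 * (\<Sum>n<2 * R. \<alpha> n * Re (cnj (u (int n + l)) * u (int (Suc n) + l)))
          + (\<Sum>n<Suc (2 * R). c n * (cmod (u (int n + l)))\<^sup>2)"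
        unfolding \<alpha>_def c_def by (rule window_form_le)
      finally show "(\<mu> k + 1 / \<mu> k) * (\<Sum>n<Suc (2 * R). (cmod (\<Sum>j\<le>k. z j * \<psi> j (int n + l)))\<^sup>2)
        - 2 * (\<Sum>n<2 * R. \<alpha> n * Re (cnj (\<Sum>j\<le>k. z j * \<psi> j (int n + l)) * (\<Sum>j\<le>k. z j * \<psi> j (int (Suc n) + l))))
        < (\<Sum>n<Suc (2 * R). c n * (cmod (\<Sum>j\<le>k. z j * \<psi> j (int n + l)))\<^sup>2)"
        unfolding jouk(3)[OF k] u_def by linarith
    qed
    moreover have "(\<Sum>k<N. 1 / \<mu> k - \<mu> k) = (\<Sum>k<N. sqrt ((E k - \<delta>)\<^sup>2 - 4))"
      by (rule sum.cong) (use jouk(4) in auto)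
    moreover have "(\<Sum>n<Suc (2 * R). c n) \<le> ?D"
    proof -
      \<comment> \<open>The excesses of the left and of the right edges are two translates of one
        series, each bounded by \<open>A\<close>.\<close>
      have shift: "int n + l - 1 = int n + (l - 1)" for n by simp
      have "(\<Sum>n<Suc (2 * R). c n) = (\<Sum>n<Suc (2 * R). max (b (int n + l)) 0)
          + (\<Sum>n<Suc (2 * R). max (a (int n + l) - 1) 0) + (\<Sum>n<Suc (2 * R). max (a (int n + (l - 1)) - 1) 0)"
        unfolding c_def shift by (simp only: sum.distrib)
      also have "\<dots> \<le> (\<Sum>\<^sub>\<infinity>n. max (b n) 0) + A + A"
        unfolding A_def by (intro add_mono sum_window_le_infsum[where f = "\<lambda>k. max (b k) 0"]
            sum_window_le_infsum[where f = "\<lambda>k. max (a k - 1) 0"] sa sb) auto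
      finally show ?thesis by (simp add: A_def)
    qed
    ultimately show ?thesis by linarith
  qed
  have "((\<lambda>\<delta>. \<Sum>k<N. sqrt ((E k - \<delta>)\<^sup>2 - 4)) \<longlongrightarrow> (\<Sum>k<N. sqrt ((E k - 0)\<^sup>2 - 4))) (at_right 0)"
    by (intro tendsto_intros)
  moreover have "\<forall>\<^sub>F \<delta> in at_right 0. (\<Sum>k<N. sqrt ((E k - \<delta>)\<^sup>2 - 4)) \<le> ?D"
  proof -
    have "\<forall>\<^sub>F \<delta> in at_right 0. \<forall>k\<in>{..<N}. \<delta> < E k - 2"
      by (intro eventually_ball_finite ballI order_tendstoD(2)[OF tendsto_ident_at]) (use E in auto)
    with eventually_at_right_less[of "0::real"] show ?thesis
      by eventually_elim (rule bound)
  qed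
  ultimately have "(\<Sum>k<N. sqrt ((E k - 0)\<^sup>2 - 4)) \<le> ?D"
    by (rule tendsto_upperbound) simp
  then show ?thesis by simp
qed

text \<open>Sorting by -E lists the eigenvalues in decreasing order, with repetitions
  allowed.\<close>

lemma lieb_thirring_family:
  fixes \<psi> :: "'i \<Rightarrow> int \<Rightarrow> complex"
  assumes a: "\<And>n. a n \<ge> -1"
    and sb: "(\<lambda>n. max (b n) 0) summable_on UNIV"
    and sa: "(\<lambda>n. max (a n - 1) 0) summable_on UNIV" and S: "finite S"
    and l2: "\<And>j. j \<in> S \<Longrightarrow> \<psi> j \<in> l2"
    and ev: "\<And>j. j \<in> S \<Longrightarrow> jacobi a b (\<psi> j) = seq_scale (of_real (E j)) (\<psi> j)"
    and orth: "\<And>i j. i \<in> S \<Longrightarrow> j \<in> S \<Longrightarrow> l2_inner (\<psi> i) (\<psi> j) = (if i = j then 1 else 0)"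
    and E: "\<And>j. j \<in> S \<Longrightarrow> 2 < E j"
  shows "(\<Sum>j\<in>S. sqrt ((E j)\<^sup>2 - 4)) \<le> (\<Sum>\<^sub>\<infinity>n. max (b n) 0) + 2 * (\<Sum>\<^sub>\<infinity>n. max (a n - 1) 0)"
proof -
  obtain ys where ys: "set ys = S" "distinct ys" using finite_distinct_list[OF S] by blast
  define xs where "xs = sort_key (\<lambda>j. - E j) ys"
  have xs: "set xs = S" "distinct xs" "sorted (map (\<lambda>j. - E j) xs)" using ys by (simp_all add: xs_def)
  have mem: "xs ! j \<in> S" if "j < length xs" for j using that xs(1) nth_mem by blast
  have "(\<Sum>k<length xs. sqrt ((E (xs ! k))\<^sup>2 - 4)) \<le> (\<Sum>\<^sub>\<infinity>n. max (b n) 0) + 2 * (\<Sum>\<^sub>\<infinity>n. max (a n - 1) 0)"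
  proof (rule lieb_thirring_ordered[OF a sb sa, where \<psi> = "\<lambda>k. \<psi> (xs ! k)"])
    show "l2_inner (\<psi> (xs ! i)) (\<psi> (xs ! j)) = (if i = j then 1 else 0)" if "i < length xs" "j < length xs" for i j
      using orth[OF mem mem, OF that] nth_eq_iff_index_eq[OF xs(2) that] by simp
    show "E (xs ! k) \<le> E (xs ! j)" if "j \<le> k" "k < length xs" for j k
      using sorted_nth_mono[OF xs(3) that(1)] that by simp
  qed (use l2 ev E mem in auto)
  moreover have "(\<Sum>k<length xs. sqrt ((E (xs ! k))\<^sup>2 - 4)) = (\<Sum>j\<in>S. sqrt ((E j)\<^sup>2 - 4))"
    by (rule sum.reindex_bij_betw[OF bij_betw_nth]) (use xs in auto)
  ultimately show ?thesis by simp
qed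

section \<open>Orthonormal bases of eigenspaces\<close>

lemma has_sum_finite_family:
  fixes f :: "'i \<Rightarrow> 'n \<Rightarrow> 'a::topological_comm_monoid_add"
  assumes "\<And>i. i \<in> I \<Longrightarrow> (f i has_sum s i) A"
  shows "((\<lambda>n. \<Sum>i\<in>I. f i n) has_sum (\<Sum>i\<in>I. s i)) A"
proof (cases "finite I")
  case True
  then show ?thesis using assms
    by (induction I rule: finite_induct) (auto intro: has_sum_add)
qed simp

lemma l2_inner_cnj: "cnj (l2_inner u v) = l2_inner v u"
  unfolding l2_inner_def infsum_cnj[symmetric] by (simp add: mult.commute)

lemma l2_inner_self:
  assumes "u \<in> l2"
  shows "l2_inner u u = of_real (\<Sum>\<^sub>\<infinity>n. (cmod (u n))\<^sup>2)"
proof -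
  have "((\<lambda>n. of_real ((cmod (u n))\<^sup>2)) has_sum complex_of_real (\<Sum>\<^sub>\<infinity>n. (cmod (u n))\<^sup>2)) UNIV"
    using assms by (intro has_sum_of_real has_sum_infsum) (simp add: l2_def)
  moreover have "complex_of_real ((cmod (u n))\<^sup>2) = cnj (u n) * u n" for n
    by (simp only: complex_norm_square mult.commute)
  ultimately show ?thesis unfolding l2_inner_def by (simp only: infsumI)
qed

lemma l2_add:
  assumes "u \<in> l2" "v \<in> l2"
  shows "u + v \<in> l2"
proof -
  have "(\<lambda>n. 2 * (cmod (u n))\<^sup>2 + 2 * (cmod (v n))\<^sup>2) summable_on UNIV"
    using assms by (intro summable_on_add summable_on_cmult_right) (auto simp: l2_def)
  then have "(\<lambda>n. (cmod ((u + v) n))\<^sup>2) summable_on UNIV"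
  proof (rule summable_on_comparison_test)
    fix n
    have "(cmod ((u + v) n))\<^sup>2 \<le> (cmod (u n) + cmod (v n))\<^sup>2"
      by (intro power_mono) (auto simp: norm_triangle_ineq)
    also have "\<dots> \<le> 2 * (cmod (u n))\<^sup>2 + 2 * (cmod (v n))\<^sup>2"
      using sum_squares_bound[of "cmod (u n)" "cmod (v n)"] by (simp add: power2_sum)
    finally show "(cmod ((u + v) n))\<^sup>2 \<le> 2 * (cmod (u n))\<^sup>2 + 2 * (cmod (v n))\<^sup>2" .
  qed simp
  then show ?thesis by (simp add: l2_def)
qed

lemma l2_scale:
  assumes "u \<in> l2"
  shows "seq_scale c u \<in> l2"
  using assms summable_on_cmult_right[of "\<lambda>n. (cmod (u n))\<^sup>2" UNIV "(cmod c)\<^sup>2"]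
  by (simp add: l2_def seq_scale_def norm_mult power_mult_distrib)

lemma subspace_eigenspace: "cseq.subspace (eigenspace (jacobi a b) E)"
proof (rule cseq.subspaceI)
  show "0 \<in> eigenspace (jacobi a b) E"
    by (auto simp: eigenspace_def l2_def jacobi_def seq_scale_def)
next
  fix x y assume "x \<in> eigenspace (jacobi a b) E" "y \<in> eigenspace (jacobi a b) E"
  moreover have "jacobi a b (x + y) = jacobi a b x + jacobi a b y"
    by (auto simp: jacobi_def fun_eq_iff algebra_simps)
  moreover have "seq_scale (of_real E) (x + y) = seq_scale (of_real E) x + seq_scale (of_real E) y"
    by (auto simp: seq_scale_def fun_eq_iff algebra_simps)
  ultimately show "x + y \<in> eigenspace (jacobi a b) E"
    by (simp add: eigenspace_def l2_add)
next
  fix c x assume "x \<in> eigenspace (jacobi a b) E"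
  moreover have "jacobi a b (seq_scale c x) = seq_scale c (jacobi a b x)"
    by (auto simp: jacobi_def seq_scale_def fun_eq_iff algebra_simps)
  moreover have "seq_scale (of_real E) (seq_scale c x) = seq_scale c (seq_scale (of_real E) x)"
    by (auto simp: seq_scale_def fun_eq_iff algebra_simps)
  ultimately show "seq_scale c x \<in> eigenspace (jacobi a b) E"
    by (simp add: eigenspace_def l2_scale)
qed

text \<open>Otherwise the eigenspace would be the span of at most \<open>k\<close> vectors. The
  first case of \<open>multiplicity_eig\<close> would then apply and give a dimension of at most
  \<open>k\<close>, so infinite multiplicity is covered as well.\<close>

lemma eigenspace_not_subset_span:
  assumes "enat k < multiplicity_eig (jacobi a b) E" and "\<And>i. i < k \<Longrightarrow> x i \<in> eigenspace (jacobi a b) E"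
  shows "\<exists>y\<in>eigenspace (jacobi a b) E. y \<notin> cseq.span (x ` {..<k})"
proof (rule ccontr)
  let ?V = "eigenspace (jacobi a b) E"
  assume "\<not> ?thesis"
  then have sub: "?V \<subseteq> cseq.span (x ` {..<k})" by auto
  moreover have "cseq.span (x ` {..<k}) \<subseteq> ?V"
    using assms(2) by (intro cseq.span_minimal subspace_eigenspace) auto
  ultimately have "\<exists>B. finite B \<and> cseq.span B = ?V" by (intro exI[of _ "x ` {..<k}"]) auto
  then have "multiplicity_eig (jacobi a b) E = enat (cseq.dim ?V)"
    by (simp add: multiplicity_eig_def)
  moreover have "cseq.dim ?V \<le> card (x ` {..<k})" by (intro cseq.dim_le_card sub) auto
  moreover have "card (x ` {..<k}) \<le> k" using card_image_le[of "{..<k}" x] by simp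
  ultimately show False using assms(1) by simp
qed

text \<open>One Gram-Schmidt step: take an eigenvector \<open>y\<close> outside the span, subtract
  its projection \<open>p\<close> and normalize. The difference is nonzero because \<open>p\<close>
  lies in the span.\<close>

lemma orthonormal_extension:
  assumes mult: "enat k < multiplicity_eig (jacobi a b) E"
    and x: "\<And>i. i < k \<Longrightarrow> x i \<in> eigenspace (jacobi a b) E"
    and orth: "\<And>i j. i < k \<Longrightarrow> j < k \<Longrightarrow> l2_inner (x i) (x j) = (if i = j then 1 else 0)"
  shows "\<exists>w\<in>eigenspace (jacobi a b) E. l2_inner w w = 1 \<and> (\<forall>i<k. l2_inner (x i) w = 0)"
proof -
  let ?V = "eigenspace (jacobi a b) E"
  have Vl2: "u \<in> l2" if "u \<in> ?V" for u using that by (simp add: eigenspace_def)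
  obtain y where y: "y \<in> ?V" "y \<notin> cseq.span (x ` {..<k})"
    using eigenspace_not_subset_span[where x = x, OF mult x] by blast
  define p where "p = (\<Sum>i<k. seq_scale (l2_inner (x i) y) (x i))"
  have p_span: "p \<in> cseq.span (x ` {..<k})"
    unfolding p_def by (intro cseq.span_sum cseq.span_scale cseq.span_base) auto
  have "p \<in> ?V"
    unfolding p_def
    by (intro cseq.subspace_sum[OF subspace_eigenspace] cseq.subspace_scale[OF subspace_eigenspace] x) auto
  then have w: "y - p \<in> ?V" by (intro cseq.subspace_diff[OF subspace_eigenspace] y)
  have p_n: "p n = (\<Sum>i<k. l2_inner (x i) y * x i n)" for n
  proof -
    have "(\<Sum>i<m. seq_scale (l2_inner (x i) y) (x i)) n = (\<Sum>i<m. l2_inner (x i) y * x i n)" for m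
      by (induction m) (simp_all add: seq_scale_def)
    then show ?thesis by (simp add: p_def)
  qed
  have orth_w: "l2_inner (x i) (y - p) = 0" if i: "i < k" for i
  proof -
    have "((\<lambda>n. cnj (x i n) * y n + (\<Sum>j<k. (- l2_inner (x j) y) * (cnj (x i n) * x j n)))
        has_sum (l2_inner (x i) y + (\<Sum>j<k. (- l2_inner (x j) y) * l2_inner (x i) (x j)))) UNIV"
      by (intro has_sum_add has_sum_finite_family has_sum_cmult_right l2_inner_has_sum Vl2 x i y) auto
    moreover have "cnj (x i n) * y n + (\<Sum>j<k. (- l2_inner (x j) y) * (cnj (x i n) * x j n))
        = cnj (x i n) * (y - p) n" for n
      by (simp add: p_n right_diff_distrib sum_distrib_left sum_negf mult_ac)
    moreover have "(\<Sum>j<k. (- l2_inner (x j) y) * l2_inner (x i) (x j))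
        = (\<Sum>j<k. if j = i then - l2_inner (x i) y else 0)"
      using i by (intro sum.cong refl) (auto simp: orth)
    then have "l2_inner (x i) y + (\<Sum>j<k. (- l2_inner (x j) y) * l2_inner (x i) (x j)) = 0"
      using i by simp
    ultimately show ?thesis unfolding l2_inner_def[of "x i" "y - p"] by (simp only: infsumI)
  qed
  define W where "W = (\<Sum>\<^sub>\<infinity>n. (cmod ((y - p) n))\<^sup>2)"
  have "y - p \<noteq> 0" using y p_span by auto
  then obtain n where n: "(y - p) n \<noteq> 0" by (metis ext zero_fun_apply)
  have "(\<lambda>n. (cmod ((y - p) n))\<^sup>2) summable_on UNIV" using Vl2[OF w] by (simp add: l2_def)
  from finite_sum_le_infsum[OF this, of "{n}"] have "(cmod ((y - p) n))\<^sup>2 \<le> W" by (simp add: W_def)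
  moreover have "0 < (cmod ((y - p) n))\<^sup>2" using n by simp
  ultimately have W: "0 < W" by linarith
  define c where "c = complex_of_real (1 / sqrt W)"
  define v where "v = seq_scale c (y - p)"
  have vV: "v \<in> ?V" unfolding v_def by (intro cseq.subspace_scale[OF subspace_eigenspace] w)
  have "l2_inner v v = cnj c * c * l2_inner (y - p) (y - p)"
  proof -
    have "((\<lambda>n. cnj c * c * (cnj ((y - p) n) * (y - p) n)) has_sum cnj c * c * l2_inner (y - p) (y - p)) UNIV"
      by (intro has_sum_cmult_right l2_inner_has_sum Vl2 w)
    moreover have "cnj c * c * (cnj ((y - p) n) * (y - p) n) = cnj (v n) * v n" for n
      by (simp only: v_def seq_scale_def complex_cnj_mult mult_ac)
    ultimately show ?thesis unfolding l2_inner_def[of v v] by (simp only: infsumI)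
  qed
  also have "\<dots> = of_real (1 / sqrt W * (1 / sqrt W) * W)"
    unfolding l2_inner_self[OF Vl2[OF w]] W_def[symmetric] c_def
    by (simp only: complex_cnj_complex_of_real of_real_mult)
  also have "1 / sqrt W * (1 / sqrt W) * W = 1" using W by simp
  finally have "l2_inner v v = 1" by simp
  moreover have "l2_inner (x i) v = 0" if i: "i < k" for i
  proof -
    have "((\<lambda>n. c * (cnj (x i n) * (y - p) n)) has_sum c * l2_inner (x i) (y - p)) UNIV"
      by (intro has_sum_cmult_right l2_inner_has_sum Vl2 w x i)
    moreover have "c * (cnj (x i n) * (y - p) n) = cnj (x i n) * v n" for n
      by (simp only: v_def seq_scale_def mult_ac)
    ultimately show ?thesis unfolding l2_inner_def[of "x i" v] orth_w[OF i] by (simp only: infsumI mult_zero_right)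
  qed
  ultimately show ?thesis using vV by blast
qed

lemma orthonormal_eigenvectors:
  assumes "enat K \<le> multiplicity_eig (jacobi a b) E"
  shows "\<exists>x. (\<forall>i<K. x i \<in> eigenspace (jacobi a b) E) \<and>
    (\<forall>i<K. \<forall>j<K. l2_inner (x i) (x j) = (if i = j then 1 else 0))"
  using assms
proof (induction K)
  case (Suc K)
  then have lt: "enat K < multiplicity_eig (jacobi a b) E"
    by (simp add: Suc_ile_eq)
  from Suc.IH[OF order.strict_implies_order[OF this]] obtain x where x: "\<And>i. i < K \<Longrightarrow> x i \<in> eigenspace (jacobi a b) E"
    "\<And>i j. i < K \<Longrightarrow> j < K \<Longrightarrow> l2_inner (x i) (x j) = (if i = j then 1 else 0)" by auto
  from orthonormal_extension[OF lt this] obtain w where w: "w \<in> eigenspace (jacobi a b) E"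
    "l2_inner w w = 1" "\<And>i. i < K \<Longrightarrow> l2_inner (x i) w = 0" by auto
  have w': "l2_inner w (x i) = 0" if "i < K" for i
    using w(3)[OF that] l2_inner_cnj[of "x i" w] by simp
  show ?case
    by (rule exI[of _ "x(K := w)"]) (use x w w' in \<open>auto simp: less_Suc_eq\<close>)
qed auto

text \<open>For each \<open>E\<close> enough orthonormal eigenvectors are chosen to reach the
  largest index paired with \<open>E\<close> in \<open>S\<close>, and (E, k) is assigned the
  \<open>k\<close>-th of them. Vectors for different \<open>E\<close> are orthogonal by
  \<open>eigenspaces_orthogonal\<close>.\<close>

lemma finite_eigenvector_family:
  assumes S: "finite S" and mult: "\<And>E k. (E, k) \<in> S \<Longrightarrow> enat k < multiplicity_eig (jacobi a b) E"
    and bdd: "\<And>n. \<bar>a n\<bar> \<le> K"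
  shows "\<exists>\<psi>. (\<forall>p\<in>S. \<psi> p \<in> eigenspace (jacobi a b) (fst p)) \<and>
    (\<forall>p\<in>S. \<forall>q\<in>S. l2_inner (\<psi> p) (\<psi> q) = (if p = q then 1 else 0))"
proof -
  have "\<exists>x. \<forall>k. (E, k) \<in> S \<longrightarrow> x k \<in> eigenspace (jacobi a b) E \<and>
    (\<forall>l. (E, l) \<in> S \<longrightarrow> l2_inner (x k) (x l) = (if k = l then 1 else 0))" for E
  proof (cases "\<exists>k. (E, k) \<in> S")
    case True
    define K where "K = {k. (E, k) \<in> S}"
    have "K \<subseteq> snd ` S" by (force simp: K_def)
    then have K: "finite K" "K \<noteq> {}" using S True finite_subset by (auto simp: K_def)
    have "(E, Max K) \<in> S" using Max_in[OF K] by (simp add: K_def)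
    then have "enat (Suc (Max K)) \<le> multiplicity_eig (jacobi a b) E"
      using mult by (simp add: Suc_ile_eq)
    from orthonormal_eigenvectors[OF this] obtain x where x:
      "\<forall>i<Suc (Max K). x i \<in> eigenspace (jacobi a b) E"
      "\<forall>i<Suc (Max K). \<forall>j<Suc (Max K). l2_inner (x i) (x j) = (if i = j then 1 else 0)" by blast
    have "k < Suc (Max K)" if "(E, k) \<in> S" for k
      using Max_ge[OF K(1), of k] that by (simp add: K_def)
    then show ?thesis using x by (intro exI[of _ x]) blast
  qed auto
  then obtain X where X: "\<And>E k. (E, k) \<in> S \<Longrightarrow> X E k \<in> eigenspace (jacobi a b) E"
    "\<And>E k l. (E, k) \<in> S \<Longrightarrow> (E, l) \<in> S \<Longrightarrow> l2_inner (X E k) (X E l) = (if k = l then 1 else 0)"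
    by metis
  have "l2_inner (X E k) (X F l) = (if (E, k) = (F, l) then 1 else 0)" if "(E, k) \<in> S" "(F, l) \<in> S" for E k F l
    using X that eigenspaces_orthogonal[OF bdd X(1)[OF that(1)] X(1)[OF that(2)]] by (cases "E = F") auto
  then have "l2_inner (X (fst p) (snd p)) (X (fst q) (snd q)) = (if p = q then 1 else 0)"
    if "p \<in> S" "q \<in> S" for p q using that by (metis prod.collapse)
  with X(1) show ?thesis
    by (intro exI[of _ "\<lambda>p. X (fst p) (snd p)"] conjI ballI) (simp_all only: prod.collapse)
qed

text \<open>Multiplication by \<open>(-1)\<^sup>n\<close> reverses the sign of both neighbours
  relative to the centre, and the diagonal is reversed through -b. An eigenvector for
  \<open>E\<close> thus becomes one for -E, with \<open>a\<close> unchanged.\<close>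

lemma jacobi_alternating:
  fixes u :: "int \<Rightarrow> complex"
  defines "v \<equiv> \<lambda>n. if even n then u n else - u n"
  shows "jacobi a (\<lambda>n. - b n) v n = (if even n then - jacobi a b u n else jacobi a b u n)"
  by (simp add: jacobi_def v_def)

lemma summable_infsum_le_of_finite_sums:
  fixes f :: "'a \<Rightarrow> real"
  assumes "\<And>x. x \<in> X \<Longrightarrow> 0 \<le> f x" and "\<And>S. finite S \<Longrightarrow> S \<subseteq> X \<Longrightarrow> sum f S \<le> D"
  shows "f summable_on X" "infsum f X \<le> D"
proof -
  show "f summable_on X"
    by (rule nonneg_bdd_above_summable_on) (use assms in \<open>auto intro!: bdd_aboveI2[where M = D]\<close>)
  then show "infsum f X \<le> D" using assms(2) by (rule infsum_le_finite_sums)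
qed

theorem mainTheorem1:
  fixes a b :: "int \<Rightarrow> real"
  assumes "\<And>n. a n \<ge> -1"
    and "(\<lambda>n. \<bar>b n\<bar>) summable_on UNIV"
    and "(\<lambda>n. max (a n - 1) 0) summable_on UNIV"
    and "(a \<longlongrightarrow> 1) at_top" and "(a \<longlongrightarrow> 1) at_bot"
  shows "(\<lambda>(E, k). sqrt (E\<^sup>2 - 4)) summable_on eigs_plus (jacobi a b)
    \<and> (\<lambda>(E, k). sqrt (E\<^sup>2 - 4)) summable_on eigs_minus (jacobi a b)
    \<and> (\<Sum>\<^sub>\<infinity>(E, k)\<in>eigs_plus (jacobi a b). sqrt (E\<^sup>2 - 4))
        + (\<Sum>\<^sub>\<infinity>(E, k)\<in>eigs_minus (jacobi a b). sqrt (E\<^sup>2 - 4))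
      \<le> (\<Sum>\<^sub>\<infinity>n. \<bar>b n\<bar>) + 4 * (\<Sum>\<^sub>\<infinity>n. max (a n - 1) 0)"
proof -
  have sb: "(\<lambda>n. max (b n) 0) summable_on UNIV" "(\<lambda>n. max (- b n) 0) summable_on UNIV"
    by (rule summable_on_comparison_test[OF assms(2)]; simp)+
  define A where "A = (\<Sum>\<^sub>\<infinity>n. max (a n - 1) 0)"
  have "max (a n - 1) 0 \<le> A" for n
    using finite_sum_le_infsum[OF assms(3), of "{n}"] by (simp add: A_def)
  then have bdd: "\<bar>a n\<bar> \<le> 1 + A" for n using assms(1)[of n] by (smt (verit))
  let ?f = "\<lambda>(E, k::nat). sqrt (E\<^sup>2 - 4)"
  \<comment> \<open>The two halves of the spectrum use the positive and the negative part of
    \<open>b\<close>, which add up to |b|; each half also costs 2 A, whence the constant 4.\<close>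
  define P where "P = (\<Sum>\<^sub>\<infinity>n. max (b n) 0) + 2 * A"
  define M where "M = (\<Sum>\<^sub>\<infinity>n. max (- b n) 0) + 2 * A"
  \<comment> \<open>\<open>sqrt\<close> of a negative real is negative here, so the nonnegativity of
    the summands rests on |E| > 2. It allows the sums over possibly infinite sets of eigenvalues to
    be bounded through finite subsets.\<close>
  have nonneg: "0 \<le> sqrt (E\<^sup>2 - 4)" if "2 < \<bar>E\<bar>" for E
    using power_mono[of 2 "\<bar>E\<bar>" 2] that by simp
  have plus: "sum ?f S \<le> P" if S: "finite S" "S \<subseteq> eigs_plus (jacobi a b)" for S
  proof -
    have "enat k < multiplicity_eig (jacobi a b) E" if "(E, k) \<in> S" for E k
      using S(2) that by (auto simp: eigs_plus_def)
    from finite_eigenvector_family[OF S(1) this bdd]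
    obtain \<psi> where \<psi>: "\<And>p. p \<in> S \<Longrightarrow> \<psi> p \<in> eigenspace (jacobi a b) (fst p)"
      "\<And>p q. p \<in> S \<Longrightarrow> q \<in> S \<Longrightarrow> l2_inner (\<psi> p) (\<psi> q) = (if p = q then 1 else 0)"
      by blast
    have "(\<Sum>p\<in>S. sqrt ((fst p)\<^sup>2 - 4)) \<le> P"
      unfolding P_def A_def
      by (rule lieb_thirring_family[where \<psi> = \<psi>, OF assms(1) sb(1) assms(3) S(1)])
        (use \<psi> S(2) in \<open>auto simp: eigenspace_def eigs_plus_def\<close>)
    then show ?thesis by (simp add: case_prod_beta)
  qed
  have minus: "sum ?f S \<le> M" if S: "finite S" "S \<subseteq> eigs_minus (jacobi a b)" for S
  proof -
    have "enat k < multiplicity_eig (jacobi a b) E" if "(E, k) \<in> S" for E k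
      using S(2) that by (auto simp: eigs_minus_def)
    from finite_eigenvector_family[OF S(1) this bdd]
    obtain \<psi> where \<psi>: "\<And>p. p \<in> S \<Longrightarrow> \<psi> p \<in> eigenspace (jacobi a b) (fst p)"
      "\<And>p q. p \<in> S \<Longrightarrow> q \<in> S \<Longrightarrow> l2_inner (\<psi> p) (\<psi> q) = (if p = q then 1 else 0)"
      by blast
    define \<phi> where "\<phi> p n = (if even n then \<psi> p n else - \<psi> p n)" for p n
    have "(\<Sum>p\<in>S. sqrt ((- fst p)\<^sup>2 - 4)) \<le> M"
      unfolding M_def A_def
    proof (rule lieb_thirring_family[where \<psi> = \<phi>, OF assms(1) sb(2) assms(3) S(1)])
      fix p assume p: "p \<in> S"
      have "cmod (\<phi> p n) = cmod (\<psi> p n)" for n by (simp add: \<phi>_def)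
      with \<psi>(1)[OF p] show "\<phi> p \<in> l2" by (simp add: eigenspace_def l2_def)
      show "jacobi a (\<lambda>n. - b n) (\<phi> p) = seq_scale (complex_of_real (- fst p)) (\<phi> p)"
        using \<psi>(1)[OF p] jacobi_alternating[of a b "\<psi> p"]
        by (auto simp: fun_eq_iff \<phi>_def[abs_def] eigenspace_def seq_scale_def)
      show "2 < - fst p" using S(2) p by (auto simp: eigs_minus_def)
    next
      fix p q assume "p \<in> S" "q \<in> S"
      moreover have "cnj (\<phi> p n) * \<phi> q n = cnj (\<psi> p n) * \<psi> q n" for n by (simp add: \<phi>_def)
      ultimately show "l2_inner (\<phi> p) (\<phi> q) = (if p = q then 1 else 0)"
        using \<psi>(2) by (simp add: l2_inner_def)
    qed
    then show ?thesis by (simp add: case_prod_beta)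
  qed
  have fp: "0 \<le> ?f x" if "x \<in> eigs_plus (jacobi a b)" for x
    using that by (auto simp: eigs_plus_def intro!: nonneg)
  have fm: "0 \<le> ?f x" if "x \<in> eigs_minus (jacobi a b)" for x
    using that by (auto simp: eigs_minus_def intro!: nonneg)
  have p: "?f summable_on eigs_plus (jacobi a b)" "infsum ?f (eigs_plus (jacobi a b)) \<le> P"
    by (rule summable_infsum_le_of_finite_sums; rule fp plus; assumption)+
  have m: "?f summable_on eigs_minus (jacobi a b)" "infsum ?f (eigs_minus (jacobi a b)) \<le> M"
    by (rule summable_infsum_le_of_finite_sums; rule fm minus; assumption)+
  have "max (b n) 0 + max (- b n) 0 = \<bar>b n\<bar>" for n by (simp add: max_def)
  then have "(\<Sum>\<^sub>\<infinity>n. \<bar>b n\<bar>) = (\<Sum>\<^sub>\<infinity>n. max (b n) 0) + (\<Sum>\<^sub>\<infinity>n. max (- b n) 0)"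
    using infsum_add[OF sb] by simp
  then have "P + M = (\<Sum>\<^sub>\<infinity>n. \<bar>b n\<bar>) + 4 * (\<Sum>\<^sub>\<infinity>n. max (a n - 1) 0)"
    by (simp add: P_def M_def A_def)
  with p(2) m(2) have "infsum ?f (eigs_plus (jacobi a b)) + infsum ?f (eigs_minus (jacobi a b))
      \<le> (\<Sum>\<^sub>\<infinity>n. \<bar>b n\<bar>) + 4 * (\<Sum>\<^sub>\<infinity>n. max (a n - 1) 0)" by linarith
  with p(1) m(1) show ?thesis by (intro conjI)
qed

end
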